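(* Let $E$ and $F$ be Banach lattices such that the norm of $E'$ is order continuous and $F$ is $\sigma$-Dedekind complete. For every positive operator $T:E\to F$, the following assertions are equivalent: (1) $T$ is an almost weak$^{\star}$ Dunford-Pettis operator. (2) $T$ is a disjoint weak$^{\star}$ Dunford-Pettis operator.
   Context: "Operator" means bounded linear map. An operator $T:E\to F$ between Banach lattices is almost weak$^{\star}$ Dunford-Pettis if $f_n(Tx_n)\to0$ for every weakly null sequence $(x_n)$ in $E$ consisting of pairwise disjoint terms and every weak$^{\star}$ null sequence $(f_n)$ in $F'$ consisting of pairwise disjoint terms. $T$ is disjoint weak$^{\star}$ Dunford-Pettis if $f_n(Tx_n)\to0$ for every norm bounded disjoint sequence $(x_n)$ in $E$ and every weak$^{\star}$ null sequence $(f_n)$ in $F'$. *)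

theory Defs
  imports
    "HOL-Analysis.Analysis"
    "HOL-Library.Lattice_Algebras"
    "HOL-Library.Lub_Glb"
begin

class banach_lattice = banach + ordered_real_vector + lattice_ab_group_add_abs +
  assumes norm_lattice: "\<bar>x\<bar> \<le> \<bar>y\<bar> \<Longrightarrow> norm x \<le> norm y"

instance real :: banach_lattice
  by standard simp

text \<open>
  Bounded operators between Banach lattices carry the usual operator order: \<open>S \<le> T\<close> iff
  \<open>T - S\<close> maps positive vectors to positive vectors. In particular \<open>0 \<le> T\<close> says that
  \<open>T\<close> is a positive operator, and \<open>'a \<Rightarrow>\<^sub>L real\<close> is the dual \<open>E'\<close> with its usual norm and order.
\<close>

instantiation blinfun :: (banach_lattice, banach_lattice) ordered_real_vector
begin

definition less_eq_blinfun :: "'a \<Rightarrow>\<^sub>L 'b \<Rightarrow> 'a \<Rightarrow>\<^sub>L 'b \<Rightarrow> bool"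
  where "S \<le> T \<longleftrightarrow> (\<forall>x\<ge>0. blinfun_apply S x \<le> blinfun_apply T x)"

definition less_blinfun :: "'a \<Rightarrow>\<^sub>L 'b \<Rightarrow> 'a \<Rightarrow>\<^sub>L 'b \<Rightarrow> bool"
  where "S < T \<longleftrightarrow> S \<le> T \<and> \<not> T \<le> S" for S T :: "'a \<Rightarrow>\<^sub>L 'b"

instance
proof
  fix S T U :: "'a \<Rightarrow>\<^sub>L 'b" and a b :: real
  show "S < T \<longleftrightarrow> S \<le> T \<and> \<not> T \<le> S"
    by (rule less_blinfun_def)
  show "S \<le> S"
    by (simp add: less_eq_blinfun_def)
  show "S \<le> T \<Longrightarrow> T \<le> U \<Longrightarrow> S \<le> U"
    unfolding less_eq_blinfun_def by (meson order_trans)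
  show "S = T" if "S \<le> T" "T \<le> S"
  proof (rule blinfun_eqI)
    fix x :: 'a
    have eq: "blinfun_apply S y = blinfun_apply T y" if "0 \<le> y" for y
      using \<open>S \<le> T\<close> \<open>T \<le> S\<close> that by (simp add: less_eq_blinfun_def order.antisym)
    have "x = pprt x - (- nprt x)"
      using prts[of x] by simp
    moreover have "0 \<le> - nprt x"
      by simp
    ultimately show "blinfun_apply S x = blinfun_apply T x"
      using eq[of "pprt x"] eq[of "- nprt x"] by (metis blinfun.diff_right zero_le_pprt)
  qed
  show "S \<le> T \<Longrightarrow> U + S \<le> U + T"
    by (simp add: less_eq_blinfun_def blinfun.add_left)
  show "S \<le> T \<Longrightarrow> 0 \<le> a \<Longrightarrow> a *\<^sub>R S \<le> a *\<^sub>R T"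
    by (simp add: less_eq_blinfun_def blinfun.scaleR_left scaleR_left_mono)
  show "a \<le> b \<Longrightarrow> 0 \<le> S \<Longrightarrow> a *\<^sub>R S \<le> b *\<^sub>R S"
    by (simp add: less_eq_blinfun_def blinfun.scaleR_left scaleR_right_mono)
qed

end

text \<open>
  Disjointness \<open>\<bar>x\<bar> \<and> \<bar>y\<bar> = 0\<close>, with moduli \<open>\<bar>x\<bar> = x \<or> (-x)\<close> and infimum expressed by the order
  alone, so that the same definition applies to a Banach lattice and to its dual. In both
  cases the moduli exist (in the dual by the Riesz--Kantorovich theorem) and are unique.
\<close>

definition order_disjoint :: "'a::ordered_ab_group_add \<Rightarrow> 'a \<Rightarrow> bool"
  where "order_disjoint x y \<longleftrightarrow>
    (\<exists>m n. isLub UNIV {x, - x} m \<and> isLub UNIV {y, - y} n \<and> isGlb UNIV {m, n} 0)"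

lemma isLub_pair_iff: "isLub UNIV {x, y} m \<longleftrightarrow> m = sup x y" for x y :: "'a::lattice"
  by (auto simp: isLub_def leastP_def isUb_def setle_def setge_def intro: order.antisym)

lemma isGlb_pair_iff: "isGlb UNIV {x, y} m \<longleftrightarrow> m = inf x y" for x y :: "'a::lattice"
  by (auto simp: isGlb_def greatestP_def isLb_def setle_def setge_def intro: order.antisym)

lemma order_disjoint_iff_inf_abs:
  "order_disjoint x y \<longleftrightarrow> inf \<bar>x\<bar> \<bar>y\<bar> = 0" for x y :: "'a::lattice_ab_group_add_abs"
  by (auto simp: order_disjoint_def isLub_pair_iff isGlb_pair_iff abs_lattice)

definition disjoint_sequence :: "(nat \<Rightarrow> 'a::ordered_ab_group_add) \<Rightarrow> bool"
  where "disjoint_sequence x \<longleftrightarrow> (\<forall>m n. m \<noteq> n \<longrightarrow> order_disjoint (x m) (x n))"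

definition weakly_null :: "(nat \<Rightarrow> 'a::real_normed_vector) \<Rightarrow> bool"
  where "weakly_null x \<longleftrightarrow> (\<forall>f :: 'a \<Rightarrow>\<^sub>L real. (\<lambda>n. blinfun_apply f (x n)) \<longlonglongrightarrow> 0)"

definition weak_star_null :: "(nat \<Rightarrow> 'a::real_normed_vector \<Rightarrow>\<^sub>L real) \<Rightarrow> bool"
  where "weak_star_null f \<longleftrightarrow> (\<forall>x. (\<lambda>n. blinfun_apply (f n) x) \<longlonglongrightarrow> 0)"

text \<open>
  The norm is order continuous if every net decreasing to \<open>0\<close> converges to \<open>0\<close> in norm. A
  decreasing net is represented by its range, a downward directed set indexed by itself;
  the lemma below recovers the statement for nets over arbitrary directed index sets.
\<close>

definition order_continuous_norm :: "'a::{order,real_normed_vector} itself \<Rightarrow> bool"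
  where "order_continuous_norm _ \<longleftrightarrow>
    (\<forall>D :: 'a set. D \<noteq> {} \<longrightarrow> (\<forall>x\<in>D. \<forall>y\<in>D. \<exists>z\<in>D. z \<le> x \<and> z \<le> y) \<longrightarrow> isGlb UNIV D 0 \<longrightarrow>
      (\<forall>e>0. \<exists>d\<in>D. \<forall>x\<in>D. x \<le> d \<longrightarrow> norm x < e))"

lemma order_continuous_norm_net:
  fixes x :: "'i \<Rightarrow> 'a::{order,real_normed_vector}"
  assumes "order_continuous_norm TYPE('a)"
    and "I \<noteq> {}" and directed: "\<And>i j. i \<in> I \<Longrightarrow> j \<in> I \<Longrightarrow> \<exists>k\<in>I. r i k \<and> r j k"
    and decreasing: "\<And>i j. i \<in> I \<Longrightarrow> j \<in> I \<Longrightarrow> r i j \<Longrightarrow> x j \<le> x i"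
    and "isGlb UNIV (x ` I) 0" and "e > 0"
  shows "\<exists>i\<in>I. \<forall>j\<in>I. r i j \<longrightarrow> norm (x j) < e"
proof -
  have "\<exists>w\<in>x ` I. w \<le> u \<and> w \<le> v" if "u \<in> x ` I" "v \<in> x ` I" for u v
    using that directed decreasing by (smt (verit) image_iff)
  then obtain d where "d \<in> x ` I" and d: "\<forall>u\<in>x ` I. u \<le> d \<longrightarrow> norm u < e"
    using assms unfolding order_continuous_norm_def by (metis image_is_empty)
  then show ?thesis
    using decreasing by auto
qed

definition sigma_dedekind_complete :: "'a::order itself \<Rightarrow> bool"
  where "sigma_dedekind_complete _ \<longleftrightarrow>
    (\<forall>A :: 'a set. countable A \<longrightarrow> A \<noteq> {} \<longrightarrow> bdd_above A \<longrightarrow> (\<exists>s. isLub UNIV A s))"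

definition almost_weak_star_Dunford_Pettis :: "('a::banach_lattice \<Rightarrow>\<^sub>L 'b::banach_lattice) \<Rightarrow> bool"
  where "almost_weak_star_Dunford_Pettis T \<longleftrightarrow>
    (\<forall>(x :: nat \<Rightarrow> 'a) (f :: nat \<Rightarrow> 'b \<Rightarrow>\<^sub>L real).
      weakly_null x \<longrightarrow> disjoint_sequence x \<longrightarrow> weak_star_null f \<longrightarrow> disjoint_sequence f \<longrightarrow>
      (\<lambda>n. blinfun_apply (f n) (blinfun_apply T (x n))) \<longlonglongrightarrow> 0)"

definition disjoint_weak_star_Dunford_Pettis :: "('a::banach_lattice \<Rightarrow>\<^sub>L 'b::banach_lattice) \<Rightarrow> bool"
  where "disjoint_weak_star_Dunford_Pettis T \<longleftrightarrow>
    (\<forall>(x :: nat \<Rightarrow> 'a) (f :: nat \<Rightarrow> 'b \<Rightarrow>\<^sub>L real).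
      bounded (range x) \<longrightarrow> disjoint_sequence x \<longrightarrow> weak_star_null f \<longrightarrow>
      (\<lambda>n. blinfun_apply (f n) (blinfun_apply T (x n))) \<longlonglongrightarrow> 0)"

end

(*  Order continuity of the dual norm makes norm bounded disjoint sequences weakly null: the
    components of a positive functional f on the bands generated by the x n sum up to at most f,
    and the tails of this sum decrease to 0, hence converge to 0 in norm.

    If f n (T (x n)) does not tend to 0 for a weakly null disjoint x n \<ge> 0 and a weak* null f, then
    along a subsequence (after a change of signs) the positive parts of the f n have disjoint minorants g n for which
    g n (T (x n)) does not tend to 0 either. What remains is that such g are weak* null when the
    range is \<sigma>-Dedekind complete. Otherwise a gliding hump yields disjoint z n in an order interval
    [0, x] with f n (z n) bounded away from 0. The suprema \<nu> A of the z n over n \<in> A exist, the set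
    functions A \<mapsto> f n (\<nu> A) are finitely additive and tend to 0 pointwise, and Phillips' lemma
    contradicts f n (\<nu> {n}) = f n (z n).

    Conversely, weakly null sequences are norm bounded by the uniform boundedness principle. *)

theory Submission
  imports Defs
begin

section \<open>Order structure of Banach lattices\<close>

text \<open>The almost property tests disjoint functionals only, whereas a weak-star null
  \<open>f\<close> is arbitrary and the images \<open>T (x n)\<close> need not be disjoint, so
  disjointness has to be created on the side of the functionals. Passing to positive parts can
  destroy weak-star convergence: the Rademacher functions tend weakly to 0 in L^2, their positive
  parts to 1/2. Disjointness of the minorants repairs this: if they stay large at some x, then along
  a subsequence they are large at disjoint vectors of [0, x], and there one can return to
  \<open>f\<close> itself.

  Making the minorants disjoint means subtracting large multiples of earlier functionals and small
  multiples of one dominating series. Weak nullity of \<open>T (x n)\<close> makes this loss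
  negligible, and positivity of \<open>T\<close> puts \<open>T (x n)\<close> in the cone, where
  inequalities between functionals can be evaluated.

  The dual is treated as an ordered vector space without lattice operations: positive parts come
  from the Riesz--Kantorovich formula, and disjointness is expressed by approximate splittings of a
  positive vector.\<close>

lemma norm_abs_lattice: "norm \<bar>x\<bar> = norm x" for x :: "'a::banach_lattice"
  by (rule order.antisym; rule norm_lattice; simp add: abs_idempotent)

lemma norm_mono_nonneg: "0 \<le> x \<Longrightarrow> x \<le> y \<Longrightarrow> norm x \<le> norm y" for x :: "'a::banach_lattice"
  by (rule norm_lattice) (frule (1) order_trans, simp)

lemma inf_scaleR: "0 < c \<Longrightarrow> inf (c *\<^sub>R x) (c *\<^sub>R y) = c *\<^sub>R inf x y" for x y :: "'a::banach_lattice"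
proof (rule order.antisym)
  assume c: "0 < c"
  let ?z = "inf (c *\<^sub>R x) (c *\<^sub>R y)"
  have "(1 / c) *\<^sub>R ?z \<le> (1 / c) *\<^sub>R (c *\<^sub>R x)" "(1 / c) *\<^sub>R ?z \<le> (1 / c) *\<^sub>R (c *\<^sub>R y)"
    using c by (intro scaleR_left_mono; simp)+
  then have "(1 / c) *\<^sub>R ?z \<le> inf x y" using c by simp
  then have "c *\<^sub>R ((1 / c) *\<^sub>R ?z) \<le> c *\<^sub>R inf x y"
    using c by (intro scaleR_left_mono) simp_all
  then show "?z \<le> c *\<^sub>R inf x y" using c by simp
qed (simp add: scaleR_left_mono)

lemma inf_add_le:
  fixes x y z :: "'a::lattice_ab_group_add"
  assumes "0 \<le> x" "0 \<le> y" "0 \<le> z"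
  shows "inf x (y + z) \<le> inf x y + inf x z"
proof -
  have "inf x y + inf x z = inf (inf (x + x) (y + x)) (inf (x + z) (y + z))"
    by (simp only: add_inf_distrib_left add_inf_distrib_right)
  moreover have "x \<le> x + x" "x \<le> x + z" "x \<le> y + x" using assms by simp_all
  ultimately show ?thesis
    by (simp add: le_infI1)
qed

lemma inf_eq_0_mono:
  fixes a b c d :: "'a::lattice_ab_group_add"
  assumes "inf a b = 0" "0 \<le> c" "c \<le> a" "0 \<le> d" "d \<le> b"
  shows "inf c d = 0"
proof (rule order.antisym)
  show "inf c d \<le> 0"
    using inf_mono[OF assms(3,5)] assms(1) by simp
  show "0 \<le> inf c d"
    using assms(2,4) by simp
qed

lemma inf_eq_0_sum:
  fixes y :: "'i \<Rightarrow> 'a::lattice_ab_group_add"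
  assumes "finite S" "\<And>i. i \<in> S \<Longrightarrow> 0 \<le> y i" "\<And>i. i \<in> S \<Longrightarrow> inf x (y i) = 0" "0 \<le> x"
  shows "inf x (sum y S) = 0"
  using assms
proof (induction S)
  case (insert i S)
  have "inf x (y i + sum y S) \<le> inf x (y i) + inf x (sum y S)"
    using insert.prems by (intro inf_add_le sum_nonneg) auto
  also have "\<dots> = 0" using insert by simp
  finally show ?case using insert
    by (auto intro!: order.antisym add_nonneg_nonneg sum_nonneg)
qed (simp add: inf_absorb2)

text \<open>For disjoint positive elements the sum is the supremum, because
  \<open>a + b = inf a b + sup a b\<close>.\<close>

lemma sum_le_of_pairwise_disjoint:
  fixes y :: "'i \<Rightarrow> 'a::lattice_ab_group_add"
  assumes "finite S" "\<And>i. i \<in> S \<Longrightarrow> 0 \<le> y i" "\<And>i. i \<in> S \<Longrightarrow> y i \<le> x"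
    "\<And>i j. i \<in> S \<Longrightarrow> j \<in> S \<Longrightarrow> i \<noteq> j \<Longrightarrow> inf (y i) (y j) = 0" "0 \<le> x"
  shows "sum y S \<le> x"
  using assms
proof (induction S)
  case (insert i S)
  have "inf (y i) (sum y S) = 0"
    using insert by (intro inf_eq_0_sum) auto
  then have "y i + sum y S = sup (y i) (sum y S)"
    using add_eq_inf_sup[of "y i" "sum y S"] by simp
  also have "\<dots> \<le> x"
    using insert by simp
  finally show ?case using insert by simp
qed simp

lemma riesz_decomposition:
  fixes x y z :: "'a::lattice_ab_group_add"
  assumes "0 \<le> x" "0 \<le> y" "0 \<le> z" "z \<le> x + y"
  obtains u v where "z = u + v" "0 \<le> u" "u \<le> x" "0 \<le> v" "v \<le> y"
proof
  show "z = inf z x + (z - inf z x)" by (metis add.commute diff_add_cancel)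
  have "z - y \<le> inf z x" using assms by (simp add: diff_le_eq)
  then show "z - inf z x \<le> y" by (metis add.commute diff_le_eq)
  show "0 \<le> z - inf z x" by (metis diff_ge_0_iff_ge inf_le1)
qed (use assms in auto)

text \<open>Up to a positive factor the two vectors are the positive and the negative part of
  \<open>x - c *\<^sub>R y\<close>. A positive functional that is small at \<open>y\<close> loses
  little on the first truncation, and for large \<open>c\<close> little is lost on the
  second.\<close>

lemma disjoint_truncations:
  fixes x y :: "'a::banach_lattice"
  assumes "0 < c"
  shows "inf (pprt (x - c *\<^sub>R y)) (pprt (y - (1 / c) *\<^sub>R x)) = 0"
proof -
  let ?d = "x - c *\<^sub>R y"
  have "y - (1 / c) *\<^sub>R x = (1 / c) *\<^sub>R (- ?d)"
    using assms by (simp add: scaleR_right_diff_distrib)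
  moreover have "pprt (a *\<^sub>R z) = a *\<^sub>R pprt z" if "0 < a" for a and z :: 'a
  proof -
    have "nprt (a *\<^sub>R (- z)) = a *\<^sub>R nprt (- z)"
      using inf_scaleR[OF that, of "- z" 0] by (simp add: nprt_def)
    then show ?thesis
      by (metis add.inverse_inverse pprt_neg scaleR_minus_right)
  qed
  ultimately have eq: "pprt (y - (1 / c) *\<^sub>R x) = (1 / c) *\<^sub>R pprt (- ?d)"
    using assms by simp
  have 0: "inf (pprt ?d) (pprt (- ?d)) = 0"
  proof -
    have "pprt ?d = ?d + pprt (- ?d)"
      using prts[of ?d] by (metis add_diff_cancel_right' diff_conv_add_uminus pprt_neg)
    then have "inf (pprt ?d) (pprt (- ?d)) = inf ?d 0 + pprt (- ?d)"
      by (metis add_0 add_inf_distrib_right)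
    then show ?thesis
      using nprt_def pprt_neg by (metis add.right_inverse)
  qed
  \<comment> \<open>A common factor \<open>?m\<close> above both 1 and \<open>1 / c\<close> keeps
    the multiples of the two parts disjoint and dominates both truncations.\<close>
  let ?u = "pprt ?d" let ?v = "pprt (- ?d)" let ?m = "max 1 (1 / c)"
  have "?m *\<^sub>R ?u \<ge> 1 *\<^sub>R ?u" by (intro scaleR_right_mono) simp_all
  then have 1: "?u \<le> ?m *\<^sub>R ?u" by simp
  have 2: "(1 / c) *\<^sub>R ?v \<le> ?m *\<^sub>R ?v" by (intro scaleR_right_mono) simp_all
  have "inf (?m *\<^sub>R ?u) (?m *\<^sub>R ?v) = 0"
    using 0 by (simp add: inf_scaleR)
  then show ?thesis unfolding eq
    using inf_eq_0_mono[OF _ _ 1 _ 2] assms by (simp add: scaleR_nonneg_nonneg)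
qed

section \<open>Positive functionals\<close>

lemma blinfun_nonneg: "0 \<le> f \<Longrightarrow> 0 \<le> x \<Longrightarrow> 0 \<le> blinfun_apply f x"
  by (simp add: less_eq_blinfun_def)

lemma blinfun_le: "f \<le> g \<Longrightarrow> 0 \<le> x \<Longrightarrow> blinfun_apply f x \<le> blinfun_apply g x"
  by (simp add: less_eq_blinfun_def)

lemma blinfun_mono: "0 \<le> f \<Longrightarrow> x \<le> y \<Longrightarrow> blinfun_apply f x \<le> blinfun_apply f y"
  using blinfun_nonneg[of f "y - x"] by (simp add: blinfun.diff_right)

lemma blinfun_le_norm: "blinfun_apply f x \<le> norm f * norm x" for f :: "'a::real_normed_vector \<Rightarrow>\<^sub>L real"
  using norm_blinfun[of f x] by (metis abs_ge_self order_trans real_norm_def)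

lemma abs_blinfun_le: "0 \<le> f \<Longrightarrow> \<bar>blinfun_apply f x\<bar> \<le> blinfun_apply f \<bar>x\<bar>"
  for f :: "'a::banach_lattice \<Rightarrow>\<^sub>L real"
  by (metis abs_ge_minus_self abs_ge_self abs_le_iff blinfun.minus_right blinfun_mono)

lemma norm_blinfun_le_of_nonneg:
  fixes f :: "'a::banach_lattice \<Rightarrow>\<^sub>L real"
  assumes "0 \<le> f" "0 \<le> C" "\<And>x. 0 \<le> x \<Longrightarrow> blinfun_apply f x \<le> C * norm x"
  shows "norm f \<le> C"
proof (rule norm_blinfun_bound)
  fix x
  show "norm (blinfun_apply f x) \<le> C * norm x"
    using abs_blinfun_le[OF assms(1), of x] assms(3)[of "\<bar>x\<bar>"] by (simp add: norm_abs_lattice)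
qed fact

text \<open>The source of all functionals built below: each is given on the cone by a supremum or a
  series and extended through the decomposition into positive and negative part.\<close>

lemma positive_functional_extension:
  fixes p :: "'a::banach_lattice \<Rightarrow> real"
  assumes add: "\<And>x y. 0 \<le> x \<Longrightarrow> 0 \<le> y \<Longrightarrow> p (x + y) = p x + p y"
    and scale: "\<And>c x. 0 < c \<Longrightarrow> 0 \<le> x \<Longrightarrow> p (c *\<^sub>R x) = c * p x"
    and nonneg: "\<And>x. 0 \<le> x \<Longrightarrow> 0 \<le> p x"
    and bound: "\<And>x. 0 \<le> x \<Longrightarrow> p x \<le> C * norm x"
  obtains g :: "'a \<Rightarrow>\<^sub>L real" where "\<And>x. 0 \<le> x \<Longrightarrow> blinfun_apply g x = p x"
proof -
  define q where "q x = p (pprt x) - p (- nprt x)" for x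
  \<comment> \<open>The value does not depend on the representation as a difference of positive
    vectors. Linearity follows by adding and scaling representations.\<close>
  have diff: "q (x - y) = p x - p y" if "0 \<le> x" "0 \<le> y" for x y
  proof -
    have "x + - nprt (x - y) = pprt (x - y) + y"
      using prts[of "x - y"] by (simp add: algebra_simps)
    then have "p x + p (- nprt (x - y)) = p (pprt (x - y)) + p y"
      using add that by (metis neg_0_le_iff_le nprt_le_zero zero_le_pprt)
    then show ?thesis by (simp add: q_def)
  qed
  have repr: "x = pprt x - (- nprt x)" for x :: 'a
    using prts[of x] by simp
  have 0: "p 0 = 0" using add[of 0 0] by simp
  have q_add: "q (x + y) = q x + q y" for x y
  proof -
    have "(pprt x - (- nprt x)) + (pprt y - (- nprt y)) = (pprt x + pprt y) - (- nprt x + - nprt y)"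
      by simp
    then have "x + y = (pprt x + pprt y) - (- nprt x + - nprt y)"
      by (simp only: repr[symmetric])
    then have "q (x + y) = p (pprt x + pprt y) - p (- nprt x + - nprt y)"
      by (metis diff add_nonneg_nonneg neg_0_le_iff_le nprt_le_zero zero_le_pprt)
    then show ?thesis using add[of "pprt x" "pprt y"] add[of "- nprt x" "- nprt y"] by (simp add: q_def)
  qed
  have q_pos: "q (c *\<^sub>R x) = c * q x" if "0 < c" for c x
  proof -
    have "c *\<^sub>R x = c *\<^sub>R pprt x - c *\<^sub>R (- nprt x)"
      by (metis repr scaleR_right_diff_distrib)
    then have "q (c *\<^sub>R x) = p (c *\<^sub>R pprt x) - p (c *\<^sub>R (- nprt x))"
      by (metis diff scaleR_nonneg_nonneg less_imp_le neg_0_le_iff_le nprt_le_zero that zero_le_pprt)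
    then show ?thesis using scale[OF that, of "pprt x"] scale[OF that, of "- nprt x"] that
      by (simp add: q_def algebra_simps)
  qed
  have q_neg: "q (- x) = - q x" for x
    using q_add[of x "- x"] diff[of 0 0] by simp
  have q_scale: "q (c *\<^sub>R x) = c * q x" for c x
    using q_pos[of c x] q_pos[of "- c" x] q_neg[of "c *\<^sub>R x"] diff[of 0 0]
    by (cases c "0::real" rule: linorder_cases) auto
  have q_bound: "\<bar>q x\<bar> \<le> norm x * (C + C)" for x
  proof -
    have "0 \<le> - nprt x" by simp
    then have "\<bar>pprt x\<bar> \<le> \<bar>x\<bar>" "\<bar>- nprt x\<bar> \<le> \<bar>x\<bar>"
      using abs_prts[of x] by (simp_all add: abs_of_nonneg abs_prts)
    then have n: "norm (pprt x) \<le> norm x" "norm (- nprt x) \<le> norm x"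
      by (auto intro: norm_lattice)
    show ?thesis
    proof (cases "C \<ge> 0")
      case True
      then have "C * norm (pprt x) \<le> C * norm x" "C * norm (- nprt x) \<le> C * norm x"
        using n by (simp_all only: mult_left_mono)
      then show ?thesis
        using nonneg[of "pprt x"] nonneg[of "- nprt x"] bound[of "pprt x"] bound[of "- nprt x"]
        unfolding q_def distrib_left by (simp add: abs_le_iff mult.commute)
    next
      \<comment> \<open>A negative bound is compatible with \<open>nonneg\<close> only on the zero
        space.\<close>
      case False
      have "x = 0" for x :: 'a
        using nonneg[of "\<bar>x\<bar>"] bound[of "\<bar>x\<bar>"] False
        by (metis abs_ge_zero mult_neg_pos not_le norm_abs_lattice order_trans zero_less_norm_iff)
      then show ?thesis using diff[of 0 0] by (metis abs_zero diff_self mult_zero_left norm_zero order_refl)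
    qed
  qed
  have "bounded_linear q"
    using q_bound by (intro bounded_linear_intro[where K = "C + C"]) (auto simp: q_add q_scale)
  then show thesis
    by (intro that[of "Blinfun q"]) (simp add: bounded_linear_Blinfun_apply q_def 0)
qed

section \<open>The positive part of a functional\<close>

lemma bdd_above_blinfun_interval: "bdd_above (blinfun_apply f ` {0..x})"
  for f :: "'a::banach_lattice \<Rightarrow>\<^sub>L real"
proof (rule bdd_aboveI2)
  fix y assume "y \<in> {0..x}"
  then have "norm y \<le> norm x" by (simp add: norm_mono_nonneg)
  then show "blinfun_apply f y \<le> norm f * norm x"
    by (meson blinfun_le_norm mult_left_mono norm_ge_zero order_trans)
qed

text \<open>The Riesz--Kantorovich formula. Riesz decomposition splits a competitor for
  \<open>x + y\<close> into competitors for \<open>x\<close> and \<open>y\<close>, which gives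
  subadditivity; adding competitors gives the converse.\<close>

lemma ex_functional_pprt:
  fixes f :: "'a::banach_lattice \<Rightarrow>\<^sub>L real"
  shows "\<exists>g :: 'a \<Rightarrow>\<^sub>L real. \<forall>x\<ge>0. blinfun_apply g x = (SUP y\<in>{0..x}. blinfun_apply f y)"
proof -
  define p where "p x = (SUP y\<in>{0..x}. blinfun_apply f y)" for x
  have upper: "blinfun_apply f y \<le> p x" if "0 \<le> y" "y \<le> x" for x y
    unfolding p_def using that by (intro cSUP_upper bdd_above_blinfun_interval) auto
  have least: "p x \<le> a" if "0 \<le> x" "\<And>y. 0 \<le> y \<Longrightarrow> y \<le> x \<Longrightarrow> blinfun_apply f y \<le> a" for x a
    unfolding p_def using that by (intro cSUP_least) auto
  obtain g :: "'a \<Rightarrow>\<^sub>L real" where "\<And>x. 0 \<le> x \<Longrightarrow> blinfun_apply g x = p x"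
  proof (rule positive_functional_extension[of p "norm f"])
    fix x y :: 'a assume xy: "0 \<le> x" "0 \<le> y"
    show "p (x + y) = p x + p y"
    proof (rule antisym)
      show "p (x + y) \<le> p x + p y"
      proof (rule least)
        fix z assume "0 \<le> z" "z \<le> x + y"
        then obtain u v where "z = u + v" "0 \<le> u" "u \<le> x" "0 \<le> v" "v \<le> y"
          using riesz_decomposition xy by metis
        then show "blinfun_apply f z \<le> p x + p y"
          using upper[of u x] upper[of v y] by (simp add: blinfun.add_right)
      qed (use xy in simp)
      have "p x \<le> p (x + y) - p y"
      proof (rule least)
        fix u assume u: "0 \<le> u" "u \<le> x"
        have "p y \<le> p (x + y) - blinfun_apply f u"
        proof (rule least)
          fix v assume "0 \<le> v" "v \<le> y"
          then show "blinfun_apply f v \<le> p (x + y) - blinfun_apply f u"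
            using u upper[of "u + v" "x + y"] by (simp add: blinfun.add_right add_mono)
        qed (use xy in simp)
        then show "blinfun_apply f u \<le> p (x + y) - p y" by simp
      qed (use xy in simp)
      then show "p x + p y \<le> p (x + y)" by simp
    qed
  next
    fix c :: real and x :: 'a assume c: "0 < c" and x: "0 \<le> x"
    have le: "p (c *\<^sub>R x) \<le> c * p x" if c: "0 < c" and x: "0 \<le> x" for c and x
    proof (rule least)
      fix y assume "0 \<le> y" "y \<le> c *\<^sub>R x"
      then have "0 \<le> (1 / c) *\<^sub>R y" "(1 / c) *\<^sub>R y \<le> x"
        using c scaleR_left_mono[of y "c *\<^sub>R x" "1 / c"] by (auto intro: scaleR_nonneg_nonneg)
      from upper[OF this] show "blinfun_apply f y \<le> c * p x"
        using c by (simp add: blinfun.scaleR_right field_simps)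
    qed (use c x in \<open>simp add: scaleR_nonneg_nonneg\<close>)
    have "p ((1 / c) *\<^sub>R (c *\<^sub>R x)) \<le> 1 / c * p (c *\<^sub>R x)"
      using c x by (intro le) (auto intro: scaleR_nonneg_nonneg)
    then show "p (c *\<^sub>R x) = c * p x"
      using le[OF c x] c by (simp add: field_simps)
  next
    fix x :: 'a assume x: "0 \<le> x"
    show "0 \<le> p x" using upper[of 0 x] x by simp
    show "p x \<le> norm f * norm x"
    proof (rule least[OF x])
      fix y assume "0 \<le> y" "y \<le> x"
      then show "blinfun_apply f y \<le> norm f * norm x"
        by (meson blinfun_le_norm mult_left_mono norm_ge_zero norm_mono_nonneg order_trans)
    qed
  qed blast
  then show ?thesis unfolding p_def by blast
qed

text \<open>The choice is harmless: the formula fixes the functional on the cone, and the cone spans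
  the space.\<close>

definition functional_pprt :: "('a::banach_lattice \<Rightarrow>\<^sub>L real) \<Rightarrow> 'a \<Rightarrow>\<^sub>L real"
  where "functional_pprt f =
    (SOME g. \<forall>x\<ge>0. blinfun_apply g x = (SUP y\<in>{0..x}. blinfun_apply f y))"

lemma functional_pprt_apply:
  "0 \<le> x \<Longrightarrow> blinfun_apply (functional_pprt f) x = (SUP y\<in>{0..x}. blinfun_apply f y)"
  using someI_ex[OF ex_functional_pprt[of f]] by (simp add: functional_pprt_def)

lemma functional_pprt_upper:
  assumes "0 \<le> y" "y \<le> x"
  shows "blinfun_apply f y \<le> blinfun_apply (functional_pprt f) x"
proof -
  have "0 \<le> x" using assms by (rule order_trans)
  then show ?thesis
    using assms by (simp add: functional_pprt_apply cSUP_upper bdd_above_blinfun_interval)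
qed

lemma functional_pprt_least:
  "0 \<le> x \<Longrightarrow> (\<And>y. 0 \<le> y \<Longrightarrow> y \<le> x \<Longrightarrow> blinfun_apply f y \<le> a) \<Longrightarrow>
    blinfun_apply (functional_pprt f) x \<le> a"
  by (subst functional_pprt_apply) (auto intro: cSUP_least)

lemma functional_pprt_approx:
  assumes "0 \<le> x" "c < blinfun_apply (functional_pprt f) x"
  obtains y where "0 \<le> y" "y \<le> x" "c < blinfun_apply f y"
  using functional_pprt_least[of x f c] assms by force

lemma functional_pprt_nonneg [simp]: "0 \<le> functional_pprt f"
  using functional_pprt_upper[of 0 _ f] by (simp add: less_eq_blinfun_def)

lemma functional_pprt_ge: "f \<le> functional_pprt f"
  by (simp add: less_eq_blinfun_def functional_pprt_upper)

lemma functional_pprt_le: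
  assumes "f \<le> h" "0 \<le> h"
  shows "functional_pprt f \<le> h"
  unfolding less_eq_blinfun_def
proof (intro allI impI functional_pprt_least)
  fix x y :: 'a assume "0 \<le> y" "y \<le> x"
  then show "blinfun_apply f y \<le> blinfun_apply h x"
    using blinfun_le[OF assms(1)] blinfun_mono[OF assms(2)] order_trans by blast
qed

lemma functional_pprt_mono: "f \<le> g \<Longrightarrow> functional_pprt f \<le> functional_pprt g"
  by (rule functional_pprt_le) (auto intro: order_trans[OF _ functional_pprt_ge])

lemma norm_functional_pprt_le: "norm (functional_pprt f) \<le> norm f"
proof (rule norm_blinfun_le_of_nonneg)
  fix x :: 'a assume "0 \<le> x"
  then show "blinfun_apply (functional_pprt f) x \<le> norm f * norm x"
    by (intro functional_pprt_least)
      (meson blinfun_le_norm mult_left_mono norm_ge_zero norm_mono_nonneg order_trans)+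
qed simp_all

text \<open>Provides the additive majorant that Phillips' lemma asks for.\<close>

lemma abs_blinfun_le_pprt:
  fixes f :: "'a::banach_lattice \<Rightarrow>\<^sub>L real"
  assumes "0 \<le> y" "y \<le> x"
  shows "\<bar>blinfun_apply f y\<bar> \<le> blinfun_apply (functional_pprt f + functional_pprt (- f)) x"
proof -
  have "0 \<le> x" using assms by (rule order_trans)
  then have "0 \<le> blinfun_apply (functional_pprt f) x" "0 \<le> blinfun_apply (functional_pprt (- f)) x"
    by (simp_all add: blinfun_nonneg)
  then show ?thesis
    using functional_pprt_upper[OF assms, of f] functional_pprt_upper[OF assms, of "- f"]
    by (auto simp: blinfun.add_left blinfun.minus_left abs_le_iff)
qed

section \<open>Disjoint functionals\<close>

text \<open>The infimum of \<open>g\<close> and \<open>h\<close> has the value inf {g (x - w) + h w}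
  over w in [0, x], and the right side says that this is 0. All later work with disjoint functionals
  goes through such splittings.\<close>

lemma order_disjoint_functional_iff:
  fixes g h :: "'a::banach_lattice \<Rightarrow>\<^sub>L real"
  assumes g: "0 \<le> g" and h: "0 \<le> h"
  shows "order_disjoint g h \<longleftrightarrow>
    (\<forall>x\<ge>0. \<forall>\<delta>>0. \<exists>w\<ge>0. w \<le> x \<and> blinfun_apply g (x - w) \<le> \<delta> \<and> blinfun_apply h w \<le> \<delta>)" (is "_ \<longleftrightarrow> ?R")
proof -
  have lub: "isLub UNIV {f, - f} m \<longleftrightarrow> m = f" if "0 \<le> f" for f m :: "'a \<Rightarrow>\<^sub>L real"
  proof -
    have "- f \<le> f" using that by (meson neg_le_0_iff_le order_trans)
    then show ?thesis
      by (auto simp: isLub_def leastP_def isUb_def setle_def setge_def intro: order.antisym)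
  qed
  have "order_disjoint g h \<longleftrightarrow> isGlb UNIV {g, h} 0"
    using g h by (simp add: order_disjoint_def lub)
  also have "\<dots> \<longleftrightarrow> (\<forall>k. k \<le> g \<longrightarrow> k \<le> h \<longrightarrow> k \<le> 0)"
    using g h by (auto simp: isGlb_def greatestP_def isLb_def setle_def setge_def)
  also have "\<dots> \<longleftrightarrow> ?R"
  proof
    assume L: "\<forall>k. k \<le> g \<longrightarrow> k \<le> h \<longrightarrow> k \<le> 0"
    \<comment> \<open>\<open>g - functional_pprt (g - h)\<close> is the infimum of \<open>g\<close>
      and \<open>h\<close>; being a common lower bound is all that \<open>L\<close> asks
      for.\<close>
    have "g - functional_pprt (g - h) \<le> h"
      using functional_pprt_ge[of "g - h"] by (metis add.commute diff_le_eq)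
    moreover have "g - functional_pprt (g - h) \<le> g" by simp
    ultimately have "g - functional_pprt (g - h) \<le> 0" using L by blast
    then have le: "g \<le> functional_pprt (g - h)" by simp
    show ?R
    proof (intro allI impI)
      fix x :: 'a and \<delta> :: real assume x: "0 \<le> x" and \<delta>: "0 < \<delta>"
      then have "blinfun_apply g x - \<delta> < blinfun_apply (functional_pprt (g - h)) x"
        using blinfun_le[OF le x] by simp
      \<comment> \<open>A near maximizer of \<open>g - h\<close> on [0, x] is a splitting:
        \<open>h w\<close> is small because \<open>g w \<le> g x\<close>, and
        \<open>g (x - w)\<close> is small because \<open>0 \<le> h w\<close>.\<close>
      then obtain w where w: "0 \<le> w" "w \<le> x" "blinfun_apply g x - \<delta> < blinfun_apply (g - h) w"
        using functional_pprt_approx x by metis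
      then have "blinfun_apply g w \<le> blinfun_apply g x" "0 \<le> blinfun_apply h w"
        using g h by (auto intro: blinfun_mono blinfun_nonneg)
      then show "\<exists>w\<ge>0. w \<le> x \<and> blinfun_apply g (x - w) \<le> \<delta> \<and> blinfun_apply h w \<le> \<delta>"
        using w by (intro exI[of _ w]) (auto simp: blinfun.diff_left blinfun.diff_right)
    qed
  next
    assume R: ?R
    show "\<forall>k. k \<le> g \<longrightarrow> k \<le> h \<longrightarrow> k \<le> 0"
    proof (intro allI impI)
      fix k assume k: "k \<le> g" "k \<le> h"
      have "blinfun_apply k x \<le> 0" if x: "0 \<le> x" for x
      proof (rule field_le_epsilon)
        fix e :: real assume "0 < e"
        then obtain w where w: "0 \<le> w" "w \<le> x" "blinfun_apply g (x - w) \<le> e / 2" "blinfun_apply h w \<le> e / 2"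
          using R x half_gt_zero by blast
        then have "blinfun_apply k (x - w) \<le> e / 2" "blinfun_apply k w \<le> e / 2"
          using k by (meson blinfun_le diff_ge_0_iff_ge order_trans)+
        then show "blinfun_apply k x \<le> 0 + e" by (simp add: blinfun.diff_right)
      qed
      then show "k \<le> 0" by (simp add: less_eq_blinfun_def)
    qed
  qed
  finally show ?thesis .
qed

lemma order_disjoint_functional_mono:
  fixes g h :: "'a::banach_lattice \<Rightarrow>\<^sub>L real"
  assumes "order_disjoint g h" "0 \<le> g'" "g' \<le> g" "0 \<le> h'" "h' \<le> h"
  shows "order_disjoint g' h'"
proof -
  have gh: "0 \<le> g" "0 \<le> h"
    using assms(2-5) by (meson order_trans)+
  show ?thesis
    unfolding order_disjoint_functional_iff[OF assms(2,4)]
  proof (intro allI impI)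
    fix x :: 'a and \<delta> :: real assume "0 \<le> x" "0 < \<delta>"
    then obtain w where w: "0 \<le> w" "w \<le> x" "blinfun_apply g (x - w) \<le> \<delta>" "blinfun_apply h w \<le> \<delta>"
      using assms(1) unfolding order_disjoint_functional_iff[OF gh] by meson
    then have "blinfun_apply g' (x - w) \<le> \<delta>" "blinfun_apply h' w \<le> \<delta>"
      using assms by (meson blinfun_le diff_ge_0_iff_ge order_trans)+
    then show "\<exists>w\<ge>0. w \<le> x \<and> blinfun_apply g' (x - w) \<le> \<delta> \<and> blinfun_apply h' w \<le> \<delta>"
      using w by blast
  qed
qed

text \<open>Split \<open>x\<close> at a point \<open>w\<close> where \<open>f\<close> nearly attains
  its supremum over [0, x]: little of the positive part is left on \<open>x - w\<close>, and the
  negative part, being at most \<open>functional_pprt f - f\<close>, is small at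
  \<open>w\<close>.\<close>

lemma order_disjoint_functional_pprt:
  fixes f :: "'a::banach_lattice \<Rightarrow>\<^sub>L real"
  shows "order_disjoint (functional_pprt f) (functional_pprt (- f))"
proof -
  let ?p = "functional_pprt f" and ?n = "functional_pprt (- f)"
  have "?n \<le> ?p - f"
  proof (rule functional_pprt_le)
    show "- f \<le> ?p - f"
      using functional_pprt_nonneg[of f] by (metis add_0 add_right_mono diff_conv_add_uminus)
    show "0 \<le> ?p - f"
      using functional_pprt_ge by (metis diff_ge_0_iff_ge)
  qed
  show ?thesis
    unfolding order_disjoint_functional_iff[OF functional_pprt_nonneg functional_pprt_nonneg]
  proof (intro allI impI)
    fix x :: 'a and \<delta> :: real assume x: "0 \<le> x" and "0 < \<delta>"
    then obtain w where w: "0 \<le> w" "w \<le> x" "blinfun_apply ?p x - \<delta> < blinfun_apply f w"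
      using functional_pprt_approx[of x "blinfun_apply ?p x - \<delta>" f] by auto
    have "blinfun_apply f w \<le> blinfun_apply ?p w"
      using w functional_pprt_upper by blast
    moreover have "blinfun_apply ?n w \<le> blinfun_apply ?p w - blinfun_apply f w"
      using blinfun_le[OF \<open>?n \<le> ?p - f\<close> w(1)] by (simp add: blinfun.diff_left)
    moreover have "blinfun_apply ?p w \<le> blinfun_apply ?p x"
      using w by (intro blinfun_mono) simp_all
    ultimately show "\<exists>w\<ge>0. w \<le> x \<and> blinfun_apply ?p (x - w) \<le> \<delta> \<and> blinfun_apply ?n w \<le> \<delta>"
      using w by (intro exI[of _ w]) (auto simp: blinfun.diff_right)
  qed
qed

text \<open>The splitting for \<open>k\<close> is made inside the piece \<open>w\<close> found for
  \<open>h\<close>; the two losses of \<open>g\<close> are \<delta>/2 each.\<close>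

lemma order_disjoint_functional_add:
  fixes g h k :: "'a::banach_lattice \<Rightarrow>\<^sub>L real"
  assumes "0 \<le> g" "0 \<le> h" "0 \<le> k" and gh: "order_disjoint g h" and gk: "order_disjoint g k"
  shows "order_disjoint g (h + k)"
proof -
  have hk: "0 \<le> h + k" using assms by simp
  show ?thesis
    unfolding order_disjoint_functional_iff[OF assms(1) hk]
  proof (intro allI impI)
    fix x :: 'a and \<delta> :: real assume x: "0 \<le> x" and "0 < \<delta>"
    then have \<delta>: "0 < \<delta> / 2" by simp
    obtain w where w: "0 \<le> w" "w \<le> x" "blinfun_apply g (x - w) \<le> \<delta> / 2" "blinfun_apply h w \<le> \<delta> / 2"
      using gh x \<delta> unfolding order_disjoint_functional_iff[OF assms(1,2)] by meson
    obtain v where v: "0 \<le> v" "v \<le> w" "blinfun_apply g (w - v) \<le> \<delta> / 2" "blinfun_apply k v \<le> \<delta> / 2"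
      using gk w \<delta> unfolding order_disjoint_functional_iff[OF assms(1,3)] by meson
    have "blinfun_apply h v \<le> blinfun_apply h w" using assms v by (intro blinfun_mono)
    then show "\<exists>w\<ge>0. w \<le> x \<and> blinfun_apply g (x - w) \<le> \<delta> \<and> blinfun_apply (h + k) w \<le> \<delta>"
      using v w by (intro exI[of _ v]) (auto simp: blinfun.diff_right blinfun.add_left)
  qed
qed

lemma order_disjoint_functional_sum:
  fixes g :: "'a::banach_lattice \<Rightarrow>\<^sub>L real" and h :: "'i \<Rightarrow> 'a \<Rightarrow>\<^sub>L real"
  assumes "finite S" "0 \<le> g" "\<And>i. i \<in> S \<Longrightarrow> 0 \<le> h i" "\<And>i. i \<in> S \<Longrightarrow> order_disjoint g (h i)"
  shows "order_disjoint g (sum h S)"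
  using assms
proof (induction S)
  case empty
  then show ?case
    by (subst order_disjoint_functional_iff) (auto intro!: exI)
next
  case (insert i S)
  then show ?case
    by (auto intro!: order_disjoint_functional_add sum_nonneg)
qed

text \<open>\<open>g i\<close> is separated from the sum of the others: \<open>w\<close> serves
  \<open>g i\<close>, and the rest \<open>x - w\<close> is distributed by induction with half the
  tolerance. The other half pays for what the remaining functionals lose on
  \<open>w\<close>.\<close>

lemma split_disjoint_functionals:
  fixes g :: "'i \<Rightarrow> 'a::banach_lattice \<Rightarrow>\<^sub>L real"
  assumes "finite S" "\<And>i. i \<in> S \<Longrightarrow> 0 \<le> g i"
    and "\<And>i j. i \<in> S \<Longrightarrow> j \<in> S \<Longrightarrow> i \<noteq> j \<Longrightarrow> order_disjoint (g i) (g j)"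
    and "0 \<le> x" "0 < \<delta>"
  shows "\<exists>y. (\<forall>i\<in>S. 0 \<le> y i \<and> blinfun_apply (g i) x - \<delta> \<le> blinfun_apply (g i) (y i)) \<and> sum y S \<le> x"
  using assms
proof (induction S arbitrary: x \<delta>)
  case (insert i S)
  have nonneg: "0 \<le> g i" "0 \<le> sum g S" using insert by (auto intro: sum_nonneg)
  have "order_disjoint (g i) (sum g S)"
    using insert.hyps insert.prems(1,2) by (intro order_disjoint_functional_sum) (simp_all, metis)
  then obtain w where w: "0 \<le> w" "w \<le> x" "blinfun_apply (g i) (x - w) \<le> \<delta> / 2"
      "blinfun_apply (sum g S) w \<le> \<delta> / 2"
    unfolding order_disjoint_functional_iff[OF nonneg] using insert.prems half_gt_zero by blast
  have "\<exists>y. (\<forall>j\<in>S. 0 \<le> y j \<and> blinfun_apply (g j) (x - w) - \<delta> / 2 \<le> blinfun_apply (g j) (y j)) \<and> sum y S \<le> x - w"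
    using insert w by (intro insert.IH) auto
  then obtain y where y: "\<And>j. j \<in> S \<Longrightarrow> 0 \<le> y j"
      "\<And>j. j \<in> S \<Longrightarrow> blinfun_apply (g j) (x - w) - \<delta> / 2 \<le> blinfun_apply (g j) (y j)" "sum y S \<le> x - w"
    by blast
  have small: "blinfun_apply (g j) w \<le> \<delta> / 2" if "j \<in> S" for j
  proof -
    have "g j \<le> sum g S"
      using sum_mono2[of S "{j}" g] insert.hyps insert.prems(1) that by simp
    then show ?thesis using w blinfun_le order_trans by blast
  qed
  have "i \<notin> S" using insert by simp
  let ?y = "y(i := w)"
  have "sum ?y S = sum y S"
    using \<open>i \<notin> S\<close> by (intro sum.cong) auto
  then have "sum ?y (insert i S) \<le> x"
    using y insert.hyps by (simp add: algebra_simps)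
  moreover have "0 \<le> ?y j \<and> blinfun_apply (g j) x - \<delta> \<le> blinfun_apply (g j) (?y j)" if "j \<in> insert i S" for j
  proof (cases "j = i")
    case True
    then show ?thesis using w insert.prems by (auto simp: blinfun.diff_right)
  next
    case False
    then have "j \<in> S" using that by simp
    then show ?thesis using False y(1,2)[of j] small[of j] by (auto simp: blinfun.diff_right)
  qed
  ultimately show ?case by blast
qed simp

section \<open>Finitely additive set functions and Phillips' lemma\<close>

text \<open>Under mere finite additivity the masses of tails need not tend to 0, so the set is
  thinned out instead: of two disjoint infinite parts one carries at most half the mass, and this is
  iterated.\<close>

lemma small_infinite_subset:
  fixes \<mu> :: "nat set \<Rightarrow> real"
  assumes add: "\<And>A B. A \<inter> B = {} \<Longrightarrow> \<mu> (A \<union> B) = \<mu> A + \<mu> B" and nonneg: "\<And>A. 0 \<le> \<mu> A"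
    and "infinite I" "0 < \<delta>"
  obtains J where "J \<subseteq> I" "infinite J" "\<mu> J \<le> \<delta>"
proof -
  have half: "\<exists>J\<subseteq>I. infinite J \<and> \<mu> J \<le> \<mu> I / 2" if "infinite I" for I
  proof -
    let ?e = "enumerate I"
    have inj: "inj ?e" using that by (simp add: strict_mono_enumerate strict_mono_imp_inj_on)
    have sub: "range ?e \<subseteq> I" using that by (auto simp: enumerate_in_set)
    define A where "A = ?e ` range (\<lambda>n. 2 * n)"
    define B where "B = ?e ` range (\<lambda>n. 2 * n + 1)"
    have AB: "infinite A" "infinite B"
      unfolding A_def B_def image_image
      by (intro range_inj_infinite injI; use inj in \<open>simp add: inj_eq\<close>)+
    have sub': "A \<subseteq> I" "B \<subseteq> I" using sub by (auto simp: A_def B_def)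
    have "A \<inter> B = {}"
      unfolding A_def B_def using inj by (auto simp: inj_eq) presburger
    then have "\<mu> A + \<mu> B = \<mu> (A \<union> B)" by (simp add: add)
    also have "\<dots> \<le> \<mu> (A \<union> B) + \<mu> (I - (A \<union> B))" using nonneg by simp
    also have "\<dots> = \<mu> I"
      using sub' add[of "A \<union> B" "I - (A \<union> B)"] by (simp add: Un_absorb1)
    finally consider "\<mu> A \<le> \<mu> I / 2" | "\<mu> B \<le> \<mu> I / 2" by linarith
    then show ?thesis using AB sub' by cases blast+
  qed
  have "\<exists>J\<subseteq>I. infinite J \<and> \<mu> J \<le> \<mu> I / 2 ^ k" for k
  proof (induction k)
    case 0
    then show ?case using \<open>infinite I\<close> by auto
  next
    case (Suc k)
    then obtain J where J: "J \<subseteq> I" "infinite J" "\<mu> J \<le> \<mu> I / 2 ^ k" by blast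
    then obtain L where "L \<subseteq> J" "infinite L" "\<mu> L \<le> \<mu> J / 2" using half by blast
    then show ?case using J by (intro exI[of _ L]) auto
  qed
  moreover obtain k where "\<mu> I / 2 ^ k < \<delta>"
  proof -
    have "(\<lambda>k. \<mu> I / 2 ^ k) \<longlonglongrightarrow> 0" by (rule LIMSEQ_divide_realpow_zero) simp
    then have "\<forall>\<^sub>F k in sequentially. \<mu> I / 2 ^ k < \<delta>" using \<open>0 < \<delta>\<close> by (rule order_tendstoD)
    then show thesis using that by (auto simp: eventually_sequentially)
  qed
  ultimately show thesis using that by (meson less_imp_le order_trans)
qed

text \<open>A gliding hump on indices: along a sequence \<open>\<nu>\<close> the sets of earlier and
  of later indices contribute little to \<open>m (\<nu> k)\<close>, so the diagonal term survives in
  the value at the single set \<open>range \<nu>\<close>, against \<open>null\<close>.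
  \<open>\<mu> n\<close> plays the part of the variation of \<open>m n\<close>.\<close>

lemma Phillips_diagonal:
  fixes m \<mu> :: "nat \<Rightarrow> nat set \<Rightarrow> real"
  assumes m_add: "\<And>n A B. A \<inter> B = {} \<Longrightarrow> m n (A \<union> B) = m n A + m n B"
    and \<mu>_add: "\<And>n A B. A \<inter> B = {} \<Longrightarrow> \<mu> n (A \<union> B) = \<mu> n A + \<mu> n B"
    and bound: "\<And>n A. \<bar>m n A\<bar> \<le> \<mu> n A"
    and null: "\<And>A. (\<lambda>n. m n A) \<longlonglongrightarrow> 0"
  shows "(\<lambda>n. m n {n}) \<longlonglongrightarrow> 0"
proof (rule ccontr)
  assume "\<not> ?thesis"
  then obtain \<epsilon> where \<epsilon>: "0 < \<epsilon>" and inf: "\<And>N. \<exists>n\<ge>N. \<epsilon> \<le> \<bar>m n {n}\<bar>"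
    unfolding LIMSEQ_iff by (auto simp: not_less)
  define K where "K = {n. \<epsilon> \<le> \<bar>m n {n}\<bar>}"
  have "infinite K"
    using inf by (auto simp: K_def infinite_nat_iff_unbounded_le)
  have \<mu>_nonneg: "0 \<le> \<mu> n A" for n A
    using bound[of n A] by linarith
  have \<mu>_mono: "\<mu> n A \<le> \<mu> n B" if "A \<subseteq> B" for n A B
    using \<mu>_add[of A "B - A" n] \<mu>_nonneg[of n "B - A"] that by (simp add: Un_absorb1)
  have small: "\<exists>J\<subseteq>I \<inter> {n<..}. infinite J \<and> \<mu> n J \<le> \<epsilon> / 4" if "infinite I" for I n
  proof -
    have "infinite (I \<inter> {n<..})"
    proof
      assume "finite (I \<inter> {n<..})"
      then have "finite (I \<inter> {n<..} \<union> {..n})" by simp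
      moreover have "I \<subseteq> I \<inter> {n<..} \<union> {..n}" by auto
      ultimately show False using that finite_subset by blast
    qed
    then show ?thesis
      using small_infinite_subset[where \<mu> = "\<mu> n" and I = "I \<inter> {n<..}" and \<delta> = "\<epsilon> / 4"] \<mu>_add \<mu>_nonneg \<epsilon> by (metis zero_less_divide_iff zero_less_numeral)
  qed
  \<comment> \<open>\<open>F\<close> holds the indices chosen before \<open>n\<close>, and
    \<open>I\<close> is the reservoir for the later ones; \<open>m n\<close> sees at most
    \<epsilon>/4 of \<open>F\<close> and of any subset of \<open>I\<close>. The clause for
    \<open>k = 0\<close> anchors the identification of \<open>F k\<close> with the earlier
    indices.\<close>
  define P where "P k = (\<lambda>(F, n, I). (k = 0 \<longrightarrow> F = {}) \<and> n \<in> K \<and> I \<subseteq> K \<inter> {n<..} \<and> infinite I \<and>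
    \<mu> n I \<le> \<epsilon> / 4 \<and> \<bar>m n F\<bar> \<le> \<epsilon> / 4)" for k :: nat
  define Q where "Q = (\<lambda>(F :: nat set, n :: nat, I :: nat set) (F', n' :: nat, I'). F' = insert n F \<and> n' \<in> I \<and> I' \<subseteq> I)"
  obtain s where s: "\<And>k. P k (s k)" "\<And>k. Q (s k) (s (Suc k))"
  proof -
    have "\<exists>s. \<forall>k. P k (s k) \<and> Q (s k) (s (Suc k))"
    proof (rule dependent_nat_choice)
      obtain n where "n \<in> K" using \<open>infinite K\<close> by (metis finite.emptyI ex_in_conv)
      moreover obtain J where "J \<subseteq> K \<inter> {n<..}" "infinite J" "\<mu> n J \<le> \<epsilon> / 4"
        using small[OF \<open>infinite K\<close>] by blast
      moreover have "m n {} = 0" using m_add[of "{}" "{}" n] by simp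
      ultimately have "P 0 ({}, n, J)" using \<epsilon> by (simp add: P_def)
      then show "\<exists>x. P 0 x" ..
    next
      fix st and k assume "P k st"
      moreover obtain F n I where st: "st = (F, n, I)" by (cases st)
      ultimately have I: "n \<in> K" "I \<subseteq> K \<inter> {n<..}" "infinite I" by (auto simp: P_def)
      \<comment> \<open>The set of indices used so far is fixed before the next index is taken, so
        \<open>null\<close> controls it from some index on.\<close>
      have "\<forall>\<^sub>F j in sequentially. \<bar>m j (insert n F)\<bar> < \<epsilon> / 4"
        using tendsto_rabs_zero[OF null] \<epsilon> by (intro order_tendstoD) auto
      then obtain N where N: "\<And>j. j \<ge> N \<Longrightarrow> \<bar>m j (insert n F)\<bar> < \<epsilon> / 4"
        by (auto simp: eventually_sequentially)
      obtain n' where n': "n' \<ge> N" "n' \<in> I"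
        using I(3) by (auto simp: infinite_nat_iff_unbounded_le)
      obtain J where J: "J \<subseteq> I \<inter> {n'<..}" "infinite J" "\<mu> n' J \<le> \<epsilon> / 4"
        using small[OF I(3)] by blast
      have "P (Suc k) (insert n F, n', J)" "Q st (insert n F, n', J)"
        using I J n' N[of n'] by (auto simp: P_def Q_def st)
      then show "\<exists>y. P (Suc k) y \<and> Q st y" by blast
    qed
    then show thesis using that by blast
  qed
  define F where "F k = fst (s k)" for k
  define \<nu> where "\<nu> k = fst (snd (s k))" for k
  define I where "I k = snd (snd (s k))" for k
  have P: "\<nu> k \<in> K" "I k \<subseteq> K \<inter> {\<nu> k<..}" "\<mu> (\<nu> k) (I k) \<le> \<epsilon> / 4" "\<bar>m (\<nu> k) (F k)\<bar> \<le> \<epsilon> / 4" for k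
    using s(1)[of k] by (auto simp: P_def F_def \<nu>_def I_def split: prod.splits)
  have Q: "F (Suc k) = insert (\<nu> k) (F k)" "\<nu> (Suc k) \<in> I k" "I (Suc k) \<subseteq> I k" for k
    using s(2)[of k] by (auto simp: Q_def F_def \<nu>_def I_def split: prod.splits)
  have mono: "strict_mono \<nu>"
    using P(2) Q(2) by (auto intro!: strict_monoI_Suc)
  have I_anti: "I k \<subseteq> I j" if "j \<le> k" for j k
    using that Q(3) by (rule lift_Suc_antimono_le[rotated])
  have later: "\<nu> k \<in> I j" if "j < k" for j k
  proof -
    obtain i where "k = Suc i" "j \<le> i" using \<open>j < k\<close> by (cases k) auto
    then show ?thesis using Q(2)[of i] I_anti[of j i] by blast
  qed
  have "F 0 = {}" using s(1)[of 0] by (auto simp: P_def F_def split: prod.splits)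
  then have F_eq: "F k = \<nu> ` {..<k}" for k
    by (induction k) (auto simp: Q lessThan_Suc)
  define A where "A = range \<nu>"
  have big: "\<epsilon> / 4 \<le> \<bar>m (\<nu> k) A\<bar>" for k
  proof -
    let ?L = "\<nu> ` {k<..}"
    have lt: "\<nu> i < \<nu> j \<longleftrightarrow> i < j" for i j using mono by (simp add: strict_mono_less)
    have "A = F k \<union> ({\<nu> k} \<union> ?L)"
      unfolding A_def F_eq by (auto simp: image_iff) (metis lessThan_iff greaterThan_iff linorder_neqE_nat)
    moreover have "{\<nu> k} \<inter> ?L = {}" "F k \<inter> ({\<nu> k} \<union> ?L) = {}"
      unfolding F_eq using lt by (auto simp: strict_mono_eq[OF mono])
    ultimately have "m (\<nu> k) A = m (\<nu> k) (F k) + (m (\<nu> k) {\<nu> k} + m (\<nu> k) ?L)"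
      by (simp only: m_add)
    moreover have "\<bar>m (\<nu> k) ?L\<bar> \<le> \<epsilon> / 4"
    proof -
      have "\<mu> (\<nu> k) ?L \<le> \<mu> (\<nu> k) (I k)" using later by (intro \<mu>_mono) auto
      then show ?thesis using bound[of "\<nu> k" ?L] P(3)[of k] by linarith
    qed
    moreover have "\<epsilon> \<le> \<bar>m (\<nu> k) {\<nu> k}\<bar>" using P(1)[of k] by (simp add: K_def)
    ultimately show ?thesis using P(4)[of k] by linarith
  qed
  have "(\<lambda>k. m (\<nu> k) A) \<longlonglongrightarrow> 0"
    using LIMSEQ_subseq_LIMSEQ[OF null mono] by (simp add: o_def)
  then have "\<forall>\<^sub>F k in sequentially. \<bar>m (\<nu> k) A\<bar> < \<epsilon> / 4"
    using \<epsilon> by (intro order_tendstoD[OF tendsto_rabs_zero]) auto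
  then show False using big by (auto simp: eventually_sequentially not_less[symmetric])
qed

section \<open>Disjoint order bounded sequences\<close>

text \<open>With \<open>w = inf u s\<close>, each \<open>z\<close> in \<open>S\<close> is disjoint
  from \<open>w\<close>, so \<open>w + z = sup w z \<le> s\<close>. Thus \<open>s - w\<close> is
  again an upper bound, which forces \<open>w \<le> 0\<close>.\<close>

lemma inf_isLub_eq_0:
  fixes u s :: "'a::lattice_ab_group_add"
  assumes "isLub UNIV S s" "S \<noteq> {}" "0 \<le> u" "\<And>z. z \<in> S \<Longrightarrow> 0 \<le> z" "\<And>z. z \<in> S \<Longrightarrow> inf u z = 0"
  shows "inf u s = 0"
proof (rule order.antisym)
  let ?w = "inf u s"
  have upper: "z \<le> s" if "z \<in> S" for z using assms(1) that by (rule isLubD2)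
  obtain z0 where "z0 \<in> S" using assms(2) by blast
  then have "0 \<le> s" using order_trans[OF assms(4) upper] by blast
  then show "0 \<le> ?w" using assms(3) by simp
  have "z \<le> s - ?w" if z: "z \<in> S" for z
  proof -
    have "inf ?w z = 0"
      using inf_eq_0_mono[OF assms(5)[OF z] \<open>0 \<le> ?w\<close> inf_le1 assms(4)[OF z] order_refl] .
    then have "?w + z = sup ?w z"
      using add_eq_inf_sup[of ?w z] by simp
    also have "\<dots> \<le> s" using upper[OF z] by simp
    finally show ?thesis by (metis add.commute le_diff_eq)
  qed
  then have "isUb UNIV S (s - ?w)" by (rule isUb_UNIV_I)
  with assms(1) have "s \<le> s - ?w" by (rule isLub_le_isUb)
  then show "?w \<le> 0" by (metis add_le_same_cancel1 le_diff_eq)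
qed

text \<open>Disjointness passes to suprema in one argument and then in the other, and the sum of
  disjoint positive vectors is their supremum.\<close>

lemma disjoint_suprema_additive:
  fixes z :: "nat \<Rightarrow> 'b::banach_lattice"
  assumes complete: "sigma_dedekind_complete TYPE('b)"
    and z: "\<And>n. 0 \<le> z n" "\<And>n. z n \<le> x" and disj: "\<And>m n. m \<noteq> n \<Longrightarrow> inf (z m) (z n) = 0"
  obtains \<nu> :: "nat set \<Rightarrow> 'b"
  where "\<And>A. 0 \<le> \<nu> A" "\<And>n. \<nu> {n} = z n" "\<And>A B. A \<inter> B = {} \<Longrightarrow> \<nu> (A \<union> B) = \<nu> A + \<nu> B"
proof -
  have "0 \<le> x" using z(1) z(2) by (rule order_trans)
  \<comment> \<open>Inserting 0 covers the empty set, whose value has to be 0, and changes no other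
    supremum since \<open>z\<close> is positive.\<close>
  have "\<exists>s. isLub UNIV (insert 0 (z ` A)) s" for A
  proof -
    have "bdd_above (insert 0 (z ` A))"
      using \<open>0 \<le> x\<close> z(2) by (intro bdd_aboveI[of _ x]) auto
    then show ?thesis
      using complete unfolding sigma_dedekind_complete_def by simp
  qed
  then obtain \<nu> where \<nu>: "\<And>A. isLub UNIV (insert 0 (z ` A)) (\<nu> A)" by metis
  have upper: "y \<le> \<nu> A" if "y \<in> insert 0 (z ` A)" for y A
    using \<nu> that by (rule isLubD2)
  have least: "\<nu> A \<le> b" if "\<And>y. y \<in> insert 0 (z ` A) \<Longrightarrow> y \<le> b" for A b
    using \<nu> isUb_UNIV_I[OF that] by (rule isLub_le_isUb)
  have nonneg: "0 \<le> \<nu> A" for A using upper by simp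
  show thesis
  proof
    fix n show "\<nu> {n} = z n"
      using z(1) by (intro order.antisym least upper) auto
  next
    fix A B :: "nat set" assume AB: "A \<inter> B = {}"
    have "inf (\<nu> A) (z n) = 0" if "n \<in> B" for n
      unfolding inf.commute[of "\<nu> A"]
      using z AB that by (intro inf_isLub_eq_0[OF \<nu>]) (auto simp: inf_absorb2 intro!: disj)
    then have "inf (\<nu> A) (\<nu> B) = 0"
      using z nonneg by (intro inf_isLub_eq_0[OF \<nu>]) (auto simp: inf_absorb2)
    then have "\<nu> A + \<nu> B = sup (\<nu> A) (\<nu> B)"
      using add_eq_inf_sup[of "\<nu> A" "\<nu> B"] by simp
    also have "\<dots> = \<nu> (A \<union> B)"
    proof (rule order.antisym)
      show "sup (\<nu> A) (\<nu> B) \<le> \<nu> (A \<union> B)"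
        by (intro le_supI least upper) auto
      show "\<nu> (A \<union> B) \<le> sup (\<nu> A) (\<nu> B)"
        by (intro least) (auto intro: le_supI1 le_supI2 upper nonneg)
    qed
    finally show "\<nu> (A \<union> B) = \<nu> A + \<nu> B" by simp
  qed (rule nonneg)
qed

lemma weak_star_null_diagonal_disjoint:
  fixes f :: "nat \<Rightarrow> 'b::banach_lattice \<Rightarrow>\<^sub>L real"
  assumes "sigma_dedekind_complete TYPE('b)" and f: "weak_star_null f"
    and "\<And>n. 0 \<le> z n" "\<And>n. z n \<le> x" "\<And>m n. m \<noteq> n \<Longrightarrow> inf (z m) (z n) = 0"
  shows "(\<lambda>n. blinfun_apply (f n) (z n)) \<longlonglongrightarrow> 0"
proof -
  obtain \<nu> :: "nat set \<Rightarrow> 'b" where nonneg: "\<And>A. 0 \<le> \<nu> A" and single: "\<And>n. \<nu> {n} = z n"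
      and add: "\<And>A B. A \<inter> B = {} \<Longrightarrow> \<nu> (A \<union> B) = \<nu> A + \<nu> B"
    using disjoint_suprema_additive[of z x] assms by blast
  have "(\<lambda>n. blinfun_apply (f n) (\<nu> {n})) \<longlonglongrightarrow> 0"
  proof (rule Phillips_diagonal[where
        \<mu> = "\<lambda>n A. blinfun_apply (functional_pprt (f n) + functional_pprt (- f n)) (\<nu> A)"])
    show "\<bar>blinfun_apply (f n) (\<nu> A)\<bar> \<le>
        blinfun_apply (functional_pprt (f n) + functional_pprt (- f n)) (\<nu> A)" for n A
      using nonneg by (intro abs_blinfun_le_pprt) simp_all
    show "(\<lambda>n. blinfun_apply (f n) (\<nu> A)) \<longlonglongrightarrow> 0" for A
      using f by (simp add: weak_star_null_def)
  qed (simp_all add: add blinfun.add_right)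
  then show ?thesis by (simp add: single)
qed

section \<open>Disjoint functionals dominated by a weak* null sequence\<close>

text \<open>
  Distribute \<open>x\<close> over \<open>N\<close> of the functionals. Infinitely many of the others have mass at most
  \<open>M / N\<close> on one and the same of the \<open>N\<close> pieces, so truncating \<open>x\<close> away from that piece costs
  them little.
\<close>

lemma disjoint_functionals_step:
  fixes g :: "nat \<Rightarrow> 'b::banach_lattice \<Rightarrow>\<^sub>L real"
  assumes g: "\<And>n. 0 \<le> g n" and disj: "disjoint_sequence g"
    and x: "0 \<le> x" and I: "infinite I" and c: "\<And>n. n \<in> I \<Longrightarrow> c \<le> blinfun_apply (g n) x"
    and M: "\<And>n. blinfun_apply (g n) x \<le> M" "0 < M" and \<delta>: "0 < \<delta>"
  shows "\<exists>i y x' J. i \<in> I \<and> 0 \<le> y \<and> y \<le> x \<and> 0 \<le> x' \<and> x' \<le> x \<and> inf y x' = 0 \<and>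
    c - \<delta> \<le> blinfun_apply (g i) y \<and> infinite J \<and> J \<subseteq> I \<inter> {i<..} \<and>
    (\<forall>n\<in>J. c - \<delta> \<le> blinfun_apply (g n) x')"
proof -
  \<comment> \<open>Subtracting \<open>(1 / C) *\<^sub>R x\<close> from \<open>y i\<close> costs
    \<open>g i\<close> at most M / C = \<delta>/2; the other half of \<delta> is spent on the
    splitting.\<close>
  define C where "C = 2 * M / \<delta>"
  have C: "0 < C" using M \<delta> by (simp add: C_def)
  \<comment> \<open>With \<open>N\<close> pieces, subtracting \<open>C *\<^sub>R y i\<close> from
    \<open>x\<close> costs the surviving functionals at most C M / N \<le> \<delta>. The 1 keeps
    \<open>N\<close> positive.\<close>
  obtain N :: nat where N: "max 1 (C * M / \<delta>) \<le> real N"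
    using real_arch_simple by blast
  then have N0: "0 < real N" by simp
  have small: "C * (M / real N) \<le> \<delta>"
    using N N0 \<delta> by (simp add: field_simps)
  obtain S where S: "S \<subseteq> I" "finite S" "card S = N"
    using infinite_arbitrarily_large[OF I] by blast
  then have "S \<noteq> {}" using N0 by auto
  obtain y where y: "\<And>i. i \<in> S \<Longrightarrow> 0 \<le> y i"
      "\<And>i. i \<in> S \<Longrightarrow> blinfun_apply (g i) x - \<delta> / 2 \<le> blinfun_apply (g i) (y i)" "sum y S \<le> x"
    using split_disjoint_functionals[of S g x "\<delta> / 2"] S g x \<delta> disj
    unfolding disjoint_sequence_def by (metis half_gt_zero)
  have y_le: "y i \<le> x" if "i \<in> S" for i
  proof -
    have "y i \<le> sum y S" using sum_mono2[of S "{i}" y] S(2) y(1) that by simp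
    then show ?thesis using y(3) by (rule order_trans)
  qed
  have "\<exists>i\<in>S. blinfun_apply (g n) (y i) \<le> M / real N" for n
  proof (rule ccontr)
    assume "\<not> ?thesis"
    then have "(\<Sum>i\<in>S. M / real N) < (\<Sum>i\<in>S. blinfun_apply (g n) (y i))"
      using S \<open>S \<noteq> {}\<close> by (intro sum_strict_mono) auto
    also have "\<dots> = blinfun_apply (g n) (sum y S)" by (simp add: blinfun.sum_right)
    also have "\<dots> \<le> blinfun_apply (g n) x" using g y(3) by (intro blinfun_mono)
    also have "\<dots> \<le> M" by (rule M)
    finally show False using S N0 by simp
  qed
  then have "I = (\<Union>i\<in>S. {n \<in> I. blinfun_apply (g n) (y i) \<le> M / real N})" by auto
  then obtain i where i: "i \<in> S" and inf: "infinite {n \<in> I. blinfun_apply (g n) (y i) \<le> M / real N}"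
    using I S(2) by (metis (no_types, lifting) finite_UN_I)
  \<comment> \<open>Dropping the indices up to \<open>i\<close> makes the indices of iterated steps
    strictly increasing.\<close>
  define J where "J = {n \<in> I. blinfun_apply (g n) (y i) \<le> M / real N} - {..i}"
  have J: "infinite J" "J \<subseteq> I \<inter> {i<..}"
    using inf unfolding J_def by (auto simp: Diff_infinite_finite)
  let ?x = "pprt (x - C *\<^sub>R y i)" and ?y = "pprt (y i - (1 / C) *\<^sub>R x)"
  have "0 \<le> C *\<^sub>R y i" "0 \<le> (1 / C) *\<^sub>R x"
    using y i x C by (auto intro: scaleR_nonneg_nonneg)
  then have le: "?x \<le> x" "?y \<le> y i"
    using x y(1)[OF i] by (auto simp: pprt_def)
  have "c - \<delta> \<le> blinfun_apply (g i) ?y"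
  proof -
    have "blinfun_apply (g i) x / C \<le> M / C" using M C by (simp add: divide_right_mono)
    also have "\<dots> = \<delta> / 2" using M \<delta> by (simp add: C_def)
    finally have "c - \<delta> \<le> blinfun_apply (g i) (y i - (1 / C) *\<^sub>R x)"
      using y(2)[OF i] c[of i] S(1) i by (auto simp: blinfun.diff_right blinfun.scaleR_right)
    also have "\<dots> \<le> blinfun_apply (g i) ?y"
      using g by (intro blinfun_mono) (auto simp: pprt_def)
    finally show ?thesis .
  qed
  moreover have "c - \<delta> \<le> blinfun_apply (g n) ?x" if "n \<in> J" for n
  proof -
    have n: "n \<in> I" "blinfun_apply (g n) (y i) \<le> M / real N" using that by (auto simp: J_def)
    then have "C * blinfun_apply (g n) (y i) \<le> C * (M / real N)" using C by (intro mult_left_mono) auto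
    then have "c - \<delta> \<le> blinfun_apply (g n) (x - C *\<^sub>R y i)"
      using small c[OF n(1)] by (simp add: blinfun.diff_right blinfun.scaleR_right)
    also have "\<dots> \<le> blinfun_apply (g n) ?x"
      using g by (intro blinfun_mono) (auto simp: pprt_def)
    finally show ?thesis .
  qed
  moreover have "inf ?y ?x = 0" using disjoint_truncations[OF C, of x "y i"] by (simp add: inf.commute)
  moreover have "?y \<le> x" using le(2) y_le[OF i] by (rule order_trans)
  moreover have "i \<in> I" using i S by blast
  ultimately show ?thesis using J le(1) by (metis zero_le_pprt)
qed

section \<open>Uniform boundedness and norming functionals\<close>

theorem uniform_boundedness:
  fixes f :: "'i \<Rightarrow> 'a::banach \<Rightarrow>\<^sub>L 'b::real_normed_vector"
  assumes "\<And>x. bounded (range (\<lambda>i. blinfun_apply (f i) x))"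
  shows "bounded (range f)"
proof -
  define E where "E n = {x. \<forall>i. norm (blinfun_apply (f i) x) \<le> real n}" for n :: nat
  have closed: "closed (E n)" for n
    unfolding E_def by (intro closed_Collect_all closed_Collect_le continuous_intros)
  have cover: "\<Union> (range E) = UNIV"
  proof (intro equalityI subset_UNIV subsetI)
    fix x
    obtain B where "\<And>i. norm (blinfun_apply (f i) x) \<le> B"
      using assms[of x] unfolding bounded_iff by blast
    moreover obtain n where "B \<le> real n" using real_arch_simple by blast
    ultimately have "x \<in> E n" unfolding E_def using order_trans by blast
    then show "x \<in> \<Union> (range E)" by blast
  qed
  have "\<exists>n. interior (E n) \<noteq> {}"
  proof (rule ccontr)
    assume "\<nexists>n. interior (E n) \<noteq> {}"
    then have "Met_TC.mtopology interior_of \<Union> (range E) = {}"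
      using closed by (intro Met_TC.metric_Baire_category_alt) (auto simp: complete_UNIV)
    then show False using cover by simp
  qed
  then obtain n a r where r: "0 < r" "ball a r \<subseteq> E n"
    by (metis ex_in_conv mem_interior)
  \<comment> \<open>A vector of length r/2 is a difference of two points of the ball, so its images
    have norm at most 2n.\<close>
  define K where "K = 4 * real n / r"
  have K: "0 \<le> K" using r by (simp add: K_def)
  have bound: "norm (blinfun_apply (f i) x) \<le> K * norm x" for i x
  proof (cases "x = 0")
    case False
    define t where "t = r / (2 * norm x)"
    have t: "0 < t" using False r by (simp add: t_def)
    have "norm (t *\<^sub>R x) = r / 2" using t False r by (simp add: t_def)
    then have "a + t *\<^sub>R x \<in> ball a r" "a \<in> ball a r" using r by (simp_all add: dist_norm)
    then have "a + t *\<^sub>R x \<in> E n" "a \<in> E n" using r(2) by blast+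
    then have "norm (blinfun_apply (f i) (a + t *\<^sub>R x)) \<le> n" "norm (blinfun_apply (f i) a) \<le> n"
      by (simp_all add: E_def)
    moreover have "blinfun_apply (f i) (t *\<^sub>R x) = blinfun_apply (f i) (a + t *\<^sub>R x) - blinfun_apply (f i) a"
      by (simp add: blinfun.add_right)
    ultimately have "norm (blinfun_apply (f i) (t *\<^sub>R x)) \<le> 2 * n"
      using norm_triangle_ineq4[of "blinfun_apply (f i) (a + t *\<^sub>R x)" "blinfun_apply (f i) a"] by simp
    then have "t * norm (blinfun_apply (f i) x) \<le> 2 * n" using t by (simp add: blinfun.scaleR_right)
    then show ?thesis using False r by (simp add: t_def K_def field_simps)
  qed simp
  have "norm (f i) \<le> K" for i using K bound by (rule norm_blinfun_bound)
  then show ?thesis by (auto simp: bounded_iff)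
qed

lemma weak_star_null_bounded:
  fixes f :: "nat \<Rightarrow> 'a::banach \<Rightarrow>\<^sub>L real"
  assumes "weak_star_null f"
  shows "bounded (range f)"
  using assms unfolding weak_star_null_def
  by (intro uniform_boundedness convergent_imp_bounded) blast

section \<open>Hahn--Banach through minimal sublinear functions\<close>

definition sublinear :: "('a::real_vector \<Rightarrow> real) \<Rightarrow> bool"
  where "sublinear q \<longleftrightarrow>
    (\<forall>x y. q (x + y) \<le> q x + q y) \<and> (\<forall>c\<ge>0. \<forall>x. q (c *\<^sub>R x) = c * q x)"

lemma sublinearD:
  assumes "sublinear q"
  shows "q (x + y) \<le> q x + q y" "0 \<le> c \<Longrightarrow> q (c *\<^sub>R x) = c * q x" "q 0 = 0" "- q (- x) \<le> q x"
proof -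
  show sub: "q (x + y) \<le> q x + q y" and hom: "0 \<le> c \<Longrightarrow> q (c *\<^sub>R x) = c * q x" for x y c
    using assms by (auto simp: sublinear_def)
  show "q 0 = 0" using hom[of 0 0] by simp
  then show "- q (- x) \<le> q x" using sub[of x "- x"] by simp
qed

lemma sublinearI:
  assumes sub: "\<And>x y. q (x + y) \<le> q x + q y"
    and hom: "\<And>c x. 0 < c \<Longrightarrow> q (c *\<^sub>R x) \<le> c * q x" and zero: "q 0 = 0"
  shows "sublinear q"
  unfolding sublinear_def
proof (intro conjI allI impI sub)
  fix c :: real and x assume "0 \<le> c"
  show "q (c *\<^sub>R x) = c * q x"
  proof (cases "c = 0")
    case False
    then have c: "0 < c" using \<open>0 \<le> c\<close> by simp
    then have "q x \<le> 1 / c * q (c *\<^sub>R x)" using hom[of "1 / c" "c *\<^sub>R x"] by simp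
    then have "c * q x \<le> q (c *\<^sub>R x)" using c by (simp add: field_simps)
    then show ?thesis using hom[OF c, of x] by simp
  qed (simp add: zero)
qed

text \<open>The function z \<mapsto> inf {q (z + t y) - t q y} over t \<ge> 0 is the largest
  sublinear one below \<open>q\<close> that satisfies the last condition, which is the case t = 1 at
  z = -y. It serves twice: to make \<open>norm\<close> exact along one vector, and to show that a
  minimal function is odd.\<close>

lemma sublinear_directional:
  fixes q :: "'a::real_vector \<Rightarrow> real"
  assumes q: "sublinear q"
  obtains r where "sublinear r" "\<And>z. r z \<le> q z" "r (- y) \<le> - q y"
proof -
  define h where "h z t = q (z + t *\<^sub>R y) - t * q y" for z t
  define r where "r z = (INF t\<in>{0..}. h z t)" for z
  have bdd: "bdd_below (h z ` {0..})" for z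
  proof (rule bdd_belowI2)
    fix t :: real assume "t \<in> {0..}"
    then show "- q (- z) \<le> h z t"
      using sublinearD(1)[OF q, of "z + t *\<^sub>R y" "- z"] sublinearD(2)[OF q, of t y] by (simp add: h_def)
  qed
  have lower: "r z \<le> h z t" if "0 \<le> t" for z t
    unfolding r_def using bdd that by (intro cINF_lower) auto
  have greatest: "c \<le> r z" if "\<And>t. 0 \<le> t \<Longrightarrow> c \<le> h z t" for c z
    unfolding r_def using that by (intro cINF_greatest) auto
  show thesis
  proof
    show "r z \<le> q z" for z using lower[of 0 z] by (simp add: h_def)
    show "r (- y) \<le> - q y" using lower[of 1 "- y"] sublinearD(3)[OF q] by (simp add: h_def)
    show "sublinear r"
    proof (rule sublinearI)
      fix z w
      have "r (z + w) - h w t \<le> r z" if t: "0 \<le> t" for t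
      proof (rule greatest)
        fix s :: real assume s: "0 \<le> s"
        have "r (z + w) \<le> h (z + w) (s + t)" using s t by (intro lower) simp
        also have "\<dots> \<le> h z s + h w t"
          using sublinearD(1)[OF q, of "z + s *\<^sub>R y" "w + t *\<^sub>R y"] by (simp add: h_def algebra_simps)
        finally show "r (z + w) - h w t \<le> h z s" by simp
      qed
      then have "r (z + w) - r z \<le> r w"
        by (intro greatest) (simp add: algebra_simps)
      then show "r (z + w) \<le> r z + r w" by simp
    next
      fix c :: real and z assume c: "0 < c"
      have "r (c *\<^sub>R z) / c \<le> r z"
      proof (rule greatest)
        fix t :: real assume t: "0 \<le> t"
        have "r (c *\<^sub>R z) \<le> h (c *\<^sub>R z) (c * t)" using c t by (intro lower) simp
        also have "\<dots> = c * h z t"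
          using sublinearD(2)[OF q, of c "z + t *\<^sub>R y"] c by (simp add: h_def algebra_simps)
        finally show "r (c *\<^sub>R z) / c \<le> h z t" using c by (simp add: field_simps)
      qed
      then show "r (c *\<^sub>R z) \<le> c * r z" using c by (simp add: field_simps)
    next
      have "r 0 \<le> 0" using lower[of 0 0] sublinearD(3)[OF q] by (simp add: h_def)
      moreover have "0 \<le> r 0" using sublinearD(2)[OF q] by (intro greatest) (simp add: h_def)
      ultimately show "r 0 = 0" by simp
    qed
  qed
qed

text \<open>Zorn's lemma with pointwise infima of chains. They are finite because every sublinear
  function below \<open>p\<close> is at least \<open>- p (- x)\<close> at \<open>x\<close>, and
  subadditive because any two members of a chain have one of them below both.\<close>

lemma ex_minimal_sublinear:
  fixes p :: "'a::real_vector \<Rightarrow> real"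
  assumes "sublinear p"
  obtains q where "sublinear q" "\<And>x. q x \<le> p x"
    "\<And>r. sublinear r \<Longrightarrow> (\<And>x. r x \<le> q x) \<Longrightarrow> r = q"
proof -
  define A where "A = {q. sublinear q \<and> (\<forall>x. q x \<le> p x)}"
  define ge where "ge q r \<longleftrightarrow> (\<forall>x. r x \<le> q x)" for q r :: "'a \<Rightarrow> real"
  have "\<exists>q\<in>A. \<forall>r\<in>A. ge q r \<longrightarrow> r = q"
  proof (rule predicate_Zorn)
    show "partial_order_on A (relation_of ge A)"
      by (rule partial_order_on_relation_ofI) (auto simp: ge_def intro: order.trans intro!: ext order.antisym)
  next
    fix C assume "C \<in> Chains (relation_of ge A)"
    then have CA: "C \<subseteq> A" and chain: "\<And>q r. q \<in> C \<Longrightarrow> r \<in> C \<Longrightarrow> ge q r \<or> ge r q"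
      unfolding Chains_def relation_of_def by auto
    show "\<exists>u\<in>A. \<forall>q\<in>C. ge q u"
    proof (cases "C = {}")
      case True
      then show ?thesis using assms by (intro bexI[of _ p]) (auto simp: A_def)
    next
      case False
      define u where "u x = (INF q\<in>C. q x)" for x
      have bdd: "bdd_below ((\<lambda>q. q x) ` C)" for x
      proof (rule bdd_belowI2)
        fix q assume "q \<in> C"
        then have "sublinear q" "q (- x) \<le> p (- x)" using CA by (auto simp: A_def)
        then show "- p (- x) \<le> q x" using sublinearD(4)[of q x] by linarith
      qed
      have lower: "u x \<le> q x" if "q \<in> C" for q x
        unfolding u_def using bdd that by (rule cINF_lower)
      have greatest: "c \<le> u x" if "\<And>q. q \<in> C \<Longrightarrow> c \<le> q x" for c x
        unfolding u_def using False that by (rule cINF_greatest)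
      have "sublinear u"
      proof (rule sublinearI)
        fix x y
        have "u (x + y) - q y \<le> u x" if q: "q \<in> C" for q
        proof (rule greatest)
          fix r assume r: "r \<in> C"
          obtain s where s: "s \<in> C" "s x \<le> r x" "s y \<le> q y"
            using chain[OF q r] q r unfolding ge_def by blast
          have "u (x + y) \<le> s (x + y)" using s(1) by (rule lower)
          also have "\<dots> \<le> s x + s y" using s(1) CA sublinearD(1)[of s] by (auto simp: A_def)
          finally show "u (x + y) - q y \<le> r x" using s by simp
        qed
        then have "u (x + y) - u x \<le> u y"
          by (intro greatest) (simp add: algebra_simps)
        then show "u (x + y) \<le> u x + u y" by simp
      next
        fix c :: real and x assume c: "0 < c"
        have "u (c *\<^sub>R x) / c \<le> u x"
        proof (rule greatest)
          fix q assume q: "q \<in> C"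
          then have "q (c *\<^sub>R x) = c * q x" using CA c sublinearD(2)[of q c x] by (auto simp: A_def)
          then show "u (c *\<^sub>R x) / c \<le> q x" using lower[OF q, of "c *\<^sub>R x"] c by (simp add: field_simps)
        qed
        then show "u (c *\<^sub>R x) \<le> c * u x" using c by (simp add: field_simps)
      next
        have zero: "q 0 = 0" if "q \<in> C" for q using that CA sublinearD(3) by (auto simp: A_def)
        obtain q where "q \<in> C" using False by blast
        then have "u 0 \<le> 0" using lower[of q 0] zero[of q] by simp
        moreover have "0 \<le> u 0" by (rule greatest) (metis zero order.refl)
        ultimately show "u 0 = 0" by simp
      qed
      moreover have "u x \<le> p x" for x
      proof -
        obtain q where "q \<in> C" using False by blast
        then have "u x \<le> q x" "q x \<le> p x" using lower CA by (auto simp: A_def)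
        then show ?thesis by simp
      qed
      ultimately show ?thesis using lower by (intro bexI[of _ u]) (auto simp: A_def ge_def)
    qed
  qed
  then obtain q where q: "q \<in> A" and min: "\<And>r. r \<in> A \<Longrightarrow> ge q r \<Longrightarrow> r = q" by blast
  show thesis
  proof
    show "sublinear q" and le: "q x \<le> p x" for x using q by (auto simp: A_def)
    fix r assume "sublinear r" "\<And>x. r x \<le> q x"
    then show "r = q"
      using le by (intro min) (auto simp: A_def ge_def intro: order.trans)
  qed
qed

text \<open>A minimal sublinear function is linear, because it equals each of its directional versions.\<close>

theorem ex_norming_functional:
  fixes x :: "'a::real_normed_vector"
  obtains f :: "'a \<Rightarrow>\<^sub>L real" where "norm f \<le> 1" "norm x \<le> \<bar>blinfun_apply f x\<bar>"
proof -
  have "sublinear (norm :: 'a \<Rightarrow> real)"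
    by (auto simp: sublinear_def norm_triangle_ineq)
  \<comment> \<open>Starting from this \<open>p\<close> instead of \<open>norm\<close>, every odd
    \<open>q\<close> below it satisfies \<open>norm x \<le> q x\<close>.\<close>
  then obtain p where p: "sublinear p" "\<And>z. p z \<le> norm z" "p (- x) \<le> - norm x"
    using sublinear_directional by blast
  obtain q where q: "sublinear q" "\<And>z. q z \<le> p z"
      and min: "\<And>r. sublinear r \<Longrightarrow> (\<And>z. r z \<le> q z) \<Longrightarrow> r = q"
    using ex_minimal_sublinear[OF p(1)] by metis
  have neg: "q (- y) = - q y" for y
  proof -
    obtain r where "sublinear r" "\<And>z. r z \<le> q z" "r (- y) \<le> - q y"
      using sublinear_directional[OF q(1)] by metis
    then have "q (- y) \<le> - q y" using min by metis
    then show ?thesis using sublinearD(4)[OF q(1), of y] by simp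
  qed
  have "bounded_linear q"
  proof (rule bounded_linear_intro[where K = 1])
    show "q (y + z) = q y + q z" for y z
      using sublinearD(1)[OF q(1), of y z] sublinearD(1)[OF q(1), of "- y" "- z"] neg[of y] neg[of z] neg[of "y + z"]
      by simp
    show "q (c *\<^sub>R y) = c *\<^sub>R q y" for c y
      using sublinearD(2)[OF q(1), of c y] sublinearD(2)[OF q(1), of "- c" y] neg[of "c *\<^sub>R y"]
      by (cases "0 \<le> c") auto
    show "norm (q y) \<le> norm y * 1" for y
      using q(2)[of y] p(2)[of y] q(2)[of "- y"] p(2)[of "- y"] neg[of y] by (simp add: abs_le_iff)
  qed
  then have f: "blinfun_apply (Blinfun q) = q" by (rule bounded_linear_Blinfun_apply)
  show thesis
  proof
    show "norm (Blinfun q) \<le> 1"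
    proof (rule norm_blinfun_bound)
      show "norm (blinfun_apply (Blinfun q) y) \<le> 1 * norm y" for y
        unfolding f using q(2)[of y] p(2)[of y] q(2)[of "- y"] p(2)[of "- y"] neg[of y] by (simp add: abs_le_iff)
    qed simp
    show "norm x \<le> \<bar>blinfun_apply (Blinfun q) x\<bar>"
      unfolding f using q(2)[of "- x"] p(3) neg[of x] by linarith
  qed
qed

text \<open>Uniform boundedness is applied to the evaluations at \<open>x n\<close>, operators on
  the Banach space of functionals. A norming functional carries the bound from the evaluation back
  to the vector.\<close>

lemma weakly_null_bounded:
  fixes x :: "nat \<Rightarrow> 'a::real_normed_vector"
  assumes "weakly_null x"
  shows "bounded (range x)"
proof -
  define e where "e n = Blinfun (\<lambda>f :: 'a \<Rightarrow>\<^sub>L real. blinfun_apply f (x n))" for n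
  have e: "blinfun_apply (e n) f = blinfun_apply f (x n)" for n f
    unfolding e_def
    by (simp add: bounded_linear_Blinfun_apply bounded_linear_intros)
  have "bounded (range e)"
    using assms unfolding weakly_null_def e[symmetric]
    by (intro uniform_boundedness convergent_imp_bounded) blast
  then obtain K where K: "\<And>n. norm (e n) \<le> K" by (auto simp: bounded_iff)
  have "norm (x n) \<le> K" for n
  proof -
    obtain f :: "'a \<Rightarrow>\<^sub>L real" where f: "norm f \<le> 1" "norm (x n) \<le> \<bar>blinfun_apply f (x n)\<bar>"
      by (rule ex_norming_functional)
    have "\<bar>blinfun_apply f (x n)\<bar> \<le> norm (e n) * norm f"
      using norm_blinfun[of "e n" f] by (simp add: e)
    also have "\<dots> \<le> K * 1" using K f(1) by (intro mult_mono) (auto intro: order.trans[OF norm_ge_zero])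
    finally show ?thesis using f(2) by simp
  qed
  then show ?thesis by (auto simp: bounded_iff)
qed

section \<open>Weak-star convergence of disjoint minorants\<close>

text \<open>If the \<open>g n\<close> stayed large at some \<open>x\<close>, their disjointness
  would allow disjoint pieces of \<open>x\<close> to be cut off on which they remain large. Below
  these pieces lie disjoint points where \<open>f\<close> itself is large, and for such points
  diagonal convergence is already known.\<close>

theorem weak_star_null_dominated_disjoint:
  fixes f g :: "nat \<Rightarrow> 'b::banach_lattice \<Rightarrow>\<^sub>L real"
  assumes complete: "sigma_dedekind_complete TYPE('b)" and f: "weak_star_null f"
    and g: "\<And>n. 0 \<le> g n" "\<And>n. g n \<le> functional_pprt (f n)" and disj: "disjoint_sequence g"
  shows "weak_star_null g"
proof -
  have null: "(\<lambda>n. blinfun_apply (g n) x) \<longlonglongrightarrow> 0" if x: "0 \<le> x" for x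
  proof (rule ccontr)
    assume "\<not> ?thesis"
    then obtain \<epsilon> where \<epsilon>: "0 < \<epsilon>" and inf: "\<And>N. \<exists>n\<ge>N. \<epsilon> \<le> \<bar>blinfun_apply (g n) x\<bar>"
      unfolding LIMSEQ_iff by (auto simp: not_less)
    define K where "K = {n. \<epsilon> \<le> blinfun_apply (g n) x}"
    have "infinite K"
      using inf blinfun_nonneg[OF g(1) x] by (auto simp: K_def infinite_nat_iff_unbounded_le)
    obtain B where B: "\<And>n. norm (f n) \<le> B"
      using weak_star_null_bounded[OF f] by (auto simp: bounded_iff)
    define M where "M = max 1 (B * norm x)"
    have M: "0 < M" by (simp add: M_def)
    have g_le: "blinfun_apply (g n) y \<le> M" if y: "0 \<le> y" "y \<le> x" for n y
    proof -
      have "blinfun_apply (g n) y \<le> blinfun_apply (functional_pprt (f n)) y"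
        using g(2) y(1) by (rule blinfun_le)
      also have "\<dots> \<le> norm (functional_pprt (f n)) * norm y" by (rule blinfun_le_norm)
      also have "\<dots> \<le> B * norm x"
        using norm_functional_pprt_le[of "f n"] B[of n] norm_mono_nonneg[OF y]
        by (intro mult_mono) (auto intro: order.trans[OF norm_ge_zero])
      finally show ?thesis by (simp add: M_def)
    qed
    \<comment> \<open>The lower bound left after step \<open>k\<close>. It starts at \<epsilon> -
      \<epsilon>/4, each further step gives up \<epsilon>/2^(k+3), and it never falls below
      \<epsilon>/2.\<close>
    define c where "c k = \<epsilon> / 2 + \<epsilon> / 2 ^ (k + 2)" for k :: nat
    have c: "\<epsilon> / 2 \<le> c k" "c (Suc k) = c k - \<epsilon> / 2 ^ (k + 3)" for k
      using \<epsilon> by (simp_all add: c_def power_add field_simps)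
    \<comment> \<open>\<open>y\<close> is the hump for the index \<open>i\<close>, \<open>x'\<close>
      the remainder disjoint from it, in which all later humps are found, and \<open>J\<close> the
      indices whose functionals still have at least \<open>c k\<close> on \<open>x'\<close>.\<close>
    define P where "P k = (\<lambda>(i, y, x', J). 0 \<le> y \<and> y \<le> x \<and> 0 \<le> x' \<and> x' \<le> x \<and> inf y x' = 0 \<and>
      \<epsilon> / 2 \<le> blinfun_apply (g i) y \<and> infinite J \<and> J \<subseteq> {i<..} \<and>
      (\<forall>n\<in>J. c k \<le> blinfun_apply (g n) x'))" for k
    define Q where "Q = (\<lambda>(i :: nat, y :: 'b, x' :: 'b, J :: nat set) (j :: nat, z :: 'b, z' :: 'b, L).
      j \<in> J \<and> z \<le> x' \<and> z' \<le> x' \<and> L \<subseteq> J)"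
    have "\<exists>s. \<forall>k. P k (s k) \<and> Q (s k) (s (Suc k))"
    proof (rule dependent_nat_choice)
      have "\<exists>i y x' J. i \<in> K \<and> 0 \<le> y \<and> y \<le> x \<and> 0 \<le> x' \<and> x' \<le> x \<and> inf y x' = 0 \<and>
        \<epsilon> - \<epsilon> / 4 \<le> blinfun_apply (g i) y \<and> infinite J \<and> J \<subseteq> K \<inter> {i<..} \<and>
        (\<forall>n\<in>J. \<epsilon> - \<epsilon> / 4 \<le> blinfun_apply (g n) x')"
        using \<open>infinite K\<close> \<epsilon> x M g_le
        by (intro disjoint_functionals_step[OF g(1) disj, where M = M]) (auto simp: K_def)
      then obtain i y x' J where "0 \<le> y" "y \<le> x" "0 \<le> x'" "x' \<le> x" "inf y x' = 0"
        "\<epsilon> - \<epsilon> / 4 \<le> blinfun_apply (g i) y" "infinite J" "J \<subseteq> K \<inter> {i<..}"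
        "\<forall>n\<in>J. \<epsilon> - \<epsilon> / 4 \<le> blinfun_apply (g n) x'" by blast
      then have "P 0 (i, y, x', J)" using \<epsilon> by (auto simp: P_def c_def)
      then show "\<exists>s. P 0 s" ..
    next
      fix st k assume "P k st"
      moreover obtain i y x' J where st: "st = (i, y, x', J)" by (cases st)
      ultimately have *: "0 \<le> x'" "x' \<le> x" "infinite J" "\<And>n. n \<in> J \<Longrightarrow> c k \<le> blinfun_apply (g n) x'"
        by (auto simp: P_def)
      have "\<exists>j z z' L. j \<in> J \<and> 0 \<le> z \<and> z \<le> x' \<and> 0 \<le> z' \<and> z' \<le> x' \<and> inf z z' = 0 \<and>
        c k - \<epsilon> / 2 ^ (k + 3) \<le> blinfun_apply (g j) z \<and> infinite L \<and> L \<subseteq> J \<inter> {j<..} \<and>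
        (\<forall>n\<in>L. c k - \<epsilon> / 2 ^ (k + 3) \<le> blinfun_apply (g n) z')"
        using * \<epsilon> M g_le
        by (intro disjoint_functionals_step[OF g(1) disj, where M = M]) auto
      then obtain j z z' L where z: "j \<in> J" "0 \<le> z" "z \<le> x'" "0 \<le> z'" "z' \<le> x'" "inf z z' = 0"
        "c (Suc k) \<le> blinfun_apply (g j) z" "infinite L" "L \<subseteq> J \<inter> {j<..}"
        "\<forall>n\<in>L. c (Suc k) \<le> blinfun_apply (g n) z'" unfolding c(2) by blast
      moreover have "z \<le> x" using z(3) *(2) by (rule order.trans)
      moreover have "z' \<le> x" using z(5) *(2) by (rule order.trans)
      moreover have "\<epsilon> / 2 \<le> blinfun_apply (g j) z" using c(1)[of "Suc k"] z(7) by linarith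
      ultimately have "P (Suc k) (j, z, z', L)" "Q st (j, z, z', L)"
        by (auto simp: P_def Q_def st)
      then show "\<exists>s. P (Suc k) s \<and> Q st s" by blast
    qed
    then obtain s where s: "\<And>k. P k (s k)" "\<And>k. Q (s k) (s (Suc k))" by blast
    define i where "i k = fst (s k)" for k
    define y where "y k = fst (snd (s k))" for k
    define r where "r k = fst (snd (snd (s k)))" for k
    define J where "J k = snd (snd (snd (s k)))" for k
    have P: "0 \<le> y k" "y k \<le> x" "0 \<le> r k" "inf (y k) (r k) = 0" "\<epsilon> / 2 \<le> blinfun_apply (g (i k)) (y k)"
        "J k \<subseteq> {i k<..}" for k
      using s(1)[of k] by (auto simp: P_def i_def y_def r_def J_def split: prod.splits)
    have Q: "i (Suc k) \<in> J k" "y (Suc k) \<le> r k" "r (Suc k) \<le> r k" for k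
      using s(2)[of k] by (auto simp: Q_def i_def y_def r_def J_def split: prod.splits)
    have mono: "strict_mono i"
      using P(6) Q(1) by (auto intro!: strict_monoI_Suc)
    have y_disj: "inf (y j) (y k) = 0" if "j < k" for j k
    proof -
      obtain l where l: "k = Suc l" "j \<le> l" using \<open>j < k\<close> by (cases k) auto
      have "r l \<le> r j" using l(2) Q(3) by (rule lift_Suc_antimono_le[rotated])
      with Q(2)[of l] have "y k \<le> r j" unfolding l(1) by (rule order.trans)
      then show ?thesis using inf_eq_0_mono[OF P(4)[of j] P(1) order_refl P(1)] by blast
    qed
    \<comment> \<open>The hump is moved from \<open>g\<close> to \<open>f\<close>: the positive part
      dominates \<open>g\<close> and is a supremum of values of \<open>f\<close> on
      [0, y k].\<close>
    have "\<exists>z. 0 \<le> z \<and> z \<le> y k \<and> \<epsilon> / 4 < blinfun_apply (f (i k)) z" for k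
    proof -
      have "\<epsilon> / 4 < blinfun_apply (functional_pprt (f (i k))) (y k)"
        using blinfun_le[OF g(2) P(1), of "i k" k] P(5)[of k] \<epsilon> by linarith
      then show ?thesis using functional_pprt_approx[OF P(1)] by metis
    qed
    then obtain z where z: "\<And>k. 0 \<le> z k" "\<And>k. z k \<le> y k" "\<And>k. \<epsilon> / 4 < blinfun_apply (f (i k)) (z k)"
      by metis
    have "inf (z j) (z k) = 0" if "j \<noteq> k" for j k
    proof -
      have "inf (y j) (y k) = 0"
        using that y_disj[of j k] y_disj[of k j] by (cases "j < k") (auto simp: inf.commute)
      then show ?thesis by (rule inf_eq_0_mono[OF _ z(1,2) z(1,2)])
    qed
    moreover have "z k \<le> x" for k using z(2) P(2) by (rule order.trans)
    moreover have "weak_star_null (\<lambda>k. f (i k))"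
      using f LIMSEQ_subseq_LIMSEQ[OF _ mono] by (auto simp: weak_star_null_def o_def)
    ultimately have "(\<lambda>k. blinfun_apply (f (i k)) (z k)) \<longlonglongrightarrow> 0"
      using z(1) by (intro weak_star_null_diagonal_disjoint[OF complete])
    then have "\<forall>\<^sub>F k in sequentially. blinfun_apply (f (i k)) (z k) < \<epsilon> / 4"
      using \<epsilon> by (intro order_tendstoD) auto
    then show False using z(3) by (auto simp: eventually_sequentially not_less[symmetric] dest: less_asym)
  qed
  show ?thesis
    unfolding weak_star_null_def
  proof
    fix x :: 'b
    have "(\<lambda>n. blinfun_apply (g n) (pprt x) - blinfun_apply (g n) (- nprt x)) \<longlonglongrightarrow> 0 - 0"
      by (intro tendsto_diff null) simp_all
    moreover have "x = pprt x - (- nprt x)" using prts[of x] by simp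
    then have "blinfun_apply (g n) x = blinfun_apply (g n) (pprt x) - blinfun_apply (g n) (- nprt x)" for n
      by (metis blinfun.diff_right)
    ultimately show "(\<lambda>n. blinfun_apply (g n) x) \<longlonglongrightarrow> 0" by simp
  qed
qed

section \<open>Disjointification\<close>

lemma order_disjoint_sym:
  assumes "order_disjoint x y"
  shows "order_disjoint y x"
proof -
  obtain m n where mn: "isLub UNIV {x, - x} m" "isLub UNIV {y, - y} n" "isGlb UNIV {m, n} 0"
    using assms unfolding order_disjoint_def by blast
  have "isGlb UNIV {n, m} 0" using mn(3) by (subst insert_commute)
  then show ?thesis using mn(1,2) unfolding order_disjoint_def by blast
qed

text \<open>Each functional is cut down by a large multiple of the earlier ones and a small multiple
  of a series dominating the later ones. Both cuts cost little at \<open>u (r k)\<close>: the first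
  by the choice of \<open>r\<close>, the second because the series is one fixed functional and
  \<open>u\<close> is weakly null.\<close>

lemma disjoint_minorants:
  fixes f :: "nat \<Rightarrow> 'b::banach_lattice \<Rightarrow>\<^sub>L real"
  assumes bdd: "bounded (range f)" and u: "\<And>n. 0 \<le> u n" and null: "weakly_null u"
    and big: "\<And>n. \<epsilon> \<le> blinfun_apply (f n) (u n)" and \<epsilon>: "0 < \<epsilon>"
  obtains r :: "nat \<Rightarrow> nat" and g :: "nat \<Rightarrow> 'b \<Rightarrow>\<^sub>L real"
  where "strict_mono r" "\<And>k. 0 \<le> g k" "\<And>k. g k \<le> functional_pprt (f (r k))" "disjoint_sequence g"
    "\<forall>\<^sub>F k in sequentially. \<epsilon> / 2 \<le> blinfun_apply (g k) (u (r k))"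
proof -
  have u_null: "(\<lambda>n. blinfun_apply h (u n)) \<longlonglongrightarrow> 0" for h :: "'b \<Rightarrow>\<^sub>L real"
    using null by (simp add: weakly_null_def)
  define \<phi> where "\<phi> n = functional_pprt (f n)" for n
  have \<phi>: "0 \<le> \<phi> n" for n by (simp add: \<phi>_def)
  \<comment> \<open>The factor anticipates the coefficient of the earlier functionals in
    \<open>a\<close>. The sum includes the skipped indices, so that the condition refers only to the
    last chosen index, as dependent choice requires.\<close>
  have "\<exists>r. \<forall>k. True \<and> (r k < r (Suc k) \<and> 4 ^ Suc k * blinfun_apply (sum \<phi> {..r k}) (u (r (Suc k))) \<le> \<epsilon> / 4)"
  proof (rule dependent_nat_choice)
    fix n k :: nat
    have "(\<lambda>j. 4 ^ Suc k * blinfun_apply (sum \<phi> {..n}) (u j)) \<longlonglongrightarrow> 0"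
      by (intro tendsto_mult_right_zero u_null)
    then have "\<forall>\<^sub>F j in sequentially. 4 ^ Suc k * blinfun_apply (sum \<phi> {..n}) (u j) < \<epsilon> / 4"
      by (rule order_tendstoD) (use \<epsilon> in simp)
    then have "\<forall>\<^sub>F j in sequentially. n < j \<and> 4 ^ Suc k * blinfun_apply (sum \<phi> {..n}) (u j) < \<epsilon> / 4"
      using eventually_gt_at_top[of n] by eventually_elim simp
    then obtain j where "n < j \<and> 4 ^ Suc k * blinfun_apply (sum \<phi> {..n}) (u j) < \<epsilon> / 4"
      by (auto simp: eventually_sequentially)
    then show "\<exists>j. True \<and> n < j \<and> 4 ^ Suc k * blinfun_apply (sum \<phi> {..n}) (u j) \<le> \<epsilon> / 4"
      by (intro exI[of _ j]) auto
  qed simp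
  then obtain r :: "nat \<Rightarrow> nat" where r: "\<And>k. r k < r (Suc k)"
      "\<And>k. 4 ^ Suc k * blinfun_apply (sum \<phi> {..r k}) (u (r (Suc k))) \<le> \<epsilon> / 4" by auto
  have mono: "strict_mono r" using r(1) by (simp add: strict_monoI_Suc)
  define \<psi> where "\<psi> k = \<phi> (r k)" for k
  have \<psi>: "0 \<le> \<psi> k" for k using \<phi> by (simp add: \<psi>_def)
  obtain B where B: "\<And>n. norm (f n) \<le> B" using bdd by (auto simp: bounded_iff)
  have \<psi>_bound: "norm (\<psi> k) \<le> B" for k
    using norm_functional_pprt_le[of "f (r k)"] B[of "r k"] by (simp add: \<psi>_def \<phi>_def)
  have summ: "summable (\<lambda>k. (1 / 2) ^ k *\<^sub>R \<psi> k)"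
  proof (rule summable_comparison_test')
    show "summable (\<lambda>k. (1 / 2 :: real) ^ k * B)" by (intro summable_mult2 summable_geometric) simp
    show "norm ((1 / 2) ^ k *\<^sub>R \<psi> k) \<le> (1 / 2 :: real) ^ k * B" for k
      using \<psi>_bound[of k] by (simp add: divide_right_mono)
  qed
  \<comment> \<open>One functional that controls every later one, by
    \<open>\<psi> k \<le> 2 ^ k *\<^sub>R \<Phi>\<close>; the weights make the bounded sequence
    summable.\<close>
  define \<Phi> where "\<Phi> = (\<Sum>k. (1 / 2) ^ k *\<^sub>R \<psi> k)"
  have \<Phi>: "(1 / 2) ^ k *\<^sub>R \<psi> k \<le> \<Phi>" for k
    unfolding less_eq_blinfun_def
  proof (intro allI impI)
    fix x :: 'b assume x: "0 \<le> x"
    have nonneg: "0 \<le> (1 / 2) ^ j * blinfun_apply (\<psi> j) x" for j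
      using blinfun_nonneg[OF \<psi> x] by simp
    have "(\<lambda>j. blinfun_apply ((1 / 2) ^ j *\<^sub>R \<psi> j) x) sums blinfun_apply \<Phi> x"
      unfolding \<Phi>_def by (intro bounded_linear.sums[OF blinfun.bounded_linear_left] summable_sums summ)
    then have s: "(\<lambda>j. (1 / 2) ^ j * blinfun_apply (\<psi> j) x) sums blinfun_apply \<Phi> x"
      by (simp add: blinfun.scaleR_left)
    have "(\<Sum>j\<in>{k}. (1 / 2) ^ j * blinfun_apply (\<psi> j) x) \<le> (\<Sum>j. (1 / 2) ^ j * blinfun_apply (\<psi> j) x)"
      using nonneg s by (intro sum_le_suminf) (auto simp: sums_iff)
    then show "blinfun_apply ((1 / 2) ^ k *\<^sub>R \<psi> k) x \<le> blinfun_apply \<Phi> x"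
      using s by (simp add: sums_iff blinfun.scaleR_left)
  qed
  have \<Phi>_nonneg: "0 \<le> \<Phi>" using \<Phi>[of 0] \<psi>[of 0] by (simp add: order.trans)
  \<comment> \<open>For \<open>i < k\<close> the first subtrahend separates \<open>a k\<close> from \<open>\<psi> i\<close>, the second \<open>a i\<close> from \<open>\<psi> k\<close>.\<close>
  define a where "a k = \<psi> k - 4 ^ k *\<^sub>R sum \<psi> {..<k} - (1 / 2) ^ k *\<^sub>R \<Phi>" for k
  have sum_nonneg': "0 \<le> (4 ^ k :: real) *\<^sub>R sum \<psi> {..<k}" for k
    using \<psi> by (intro scaleR_nonneg_nonneg sum_nonneg) auto
  have \<Phi>_nonneg': "0 \<le> (1 / 2 :: real) ^ k *\<^sub>R \<Phi>" for k
    using \<Phi>_nonneg by (intro scaleR_nonneg_nonneg) auto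
  define g where "g k = functional_pprt (a k)" for k
  have disj: "order_disjoint (g k) (g i)" if "i < k" for i k
  proof -
    \<comment> \<open>The coefficient fits both sides: it is at most \<open>4 ^ k\<close> since
      \<open>i < k\<close>, and its inverse is the factor with which
      \<open>(1 / 2) ^ i *\<^sub>R \<Phi>\<close> dominates \<open>\<psi> k\<close>. So
      \<open>g k\<close> lies below the positive part of \<open>b\<close>, and \<open>g i\<close>
      below that of \<open>- b\<close>.\<close>
    define b where "b = \<psi> k - 2 ^ (i + k) *\<^sub>R \<psi> i"
    have "a k \<le> b"
    proof -
      have "(2 :: real) ^ (i + k) \<le> 2 ^ (k + k)" using that by (intro power_increasing) auto
      then have "2 ^ (i + k) *\<^sub>R \<psi> i \<le> (4 ^ k :: real) *\<^sub>R \<psi> i"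
        using \<psi> by (intro scaleR_right_mono) (simp_all add: power_add flip: power_mult_distrib)
      also have "\<dots> \<le> 4 ^ k *\<^sub>R sum \<psi> {..<k}"
        using sum_mono2[of "{..<k}" "{i}" \<psi>] \<psi> that by (intro scaleR_left_mono) auto
      finally have "\<psi> k - 4 ^ k *\<^sub>R sum \<psi> {..<k} - (1 / 2) ^ k *\<^sub>R \<Phi> \<le> \<psi> k - 2 ^ (i + k) *\<^sub>R \<psi> i - 0"
        using \<Phi>_nonneg' by (intro diff_mono order.refl)
      then show ?thesis by (simp add: a_def b_def)
    qed
    then have 1: "g k \<le> functional_pprt b" unfolding g_def by (rule functional_pprt_mono)
    have "(1 / 2) ^ i *\<^sub>R ((1 / 2) ^ k *\<^sub>R \<psi> k) \<le> (1 / 2) ^ i *\<^sub>R \<Phi>"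
      using \<Phi> by (intro scaleR_left_mono) auto
    then have "\<psi> i - 4 ^ i *\<^sub>R sum \<psi> {..<i} - (1 / 2) ^ i *\<^sub>R \<Phi> \<le> \<psi> i - 0 - (1 / 2) ^ i *\<^sub>R ((1 / 2) ^ k *\<^sub>R \<psi> k)"
      using sum_nonneg'[of i] by (intro diff_mono order.refl)
    also have "\<dots> = (1 / 2) ^ (i + k) *\<^sub>R (- b)"
      by (simp add: b_def scaleR_diff_right power_add power_divide)
    also have "\<dots> \<le> (1 / 2) ^ (i + k) *\<^sub>R functional_pprt (- b)"
      by (intro scaleR_left_mono functional_pprt_ge) simp
    also have "\<dots> \<le> 1 *\<^sub>R functional_pprt (- b)"
      by (intro scaleR_right_mono) (simp_all add: power_le_one)
    finally have "a i \<le> functional_pprt (- b)" by (simp add: a_def)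
    then have 2: "g i \<le> functional_pprt (- b)"
      unfolding g_def by (rule functional_pprt_le) simp
    show ?thesis
      using order_disjoint_functional_mono[OF order_disjoint_functional_pprt _ 1 _ 2] by (simp add: g_def)
  qed
  show thesis
  proof (rule that[of r g])
    show "strict_mono r" by (rule mono)
    show "0 \<le> g k" for k by (simp add: g_def)
    show "g k \<le> functional_pprt (f (r k))" for k
    proof -
      have "a k \<le> \<psi> k - 0 - 0"
        unfolding a_def using sum_nonneg' \<Phi>_nonneg' by (intro diff_mono order.refl)
      then have "a k \<le> functional_pprt (f (r k))" by (simp add: \<psi>_def \<phi>_def)
      then show ?thesis unfolding g_def by (rule functional_pprt_le) simp
    qed
    show "disjoint_sequence g"
      unfolding disjoint_sequence_def
    proof (intro allI impI)
      fix k i :: nat assume "k \<noteq> i"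
      then show "order_disjoint (g k) (g i)"
        using disj[of i k] order_disjoint_sym[OF disj[of k i]] by linarith
    qed
    have "(\<lambda>k. blinfun_apply \<Phi> (u (r k))) \<longlonglongrightarrow> 0"
      using LIMSEQ_subseq_LIMSEQ[OF u_null mono] by (simp add: o_def)
    then have "\<forall>\<^sub>F k in sequentially. blinfun_apply \<Phi> (u (r k)) < \<epsilon> / 4"
      using \<epsilon> by (intro order_tendstoD) auto
    then show "\<forall>\<^sub>F k in sequentially. \<epsilon> / 2 \<le> blinfun_apply (g k) (u (r k))"
    proof eventually_elim
      case (elim k)
      have 1: "4 ^ k * blinfun_apply (sum \<psi> {..<k}) (u (r k)) \<le> \<epsilon> / 4"
      proof (cases k)
        case 0
        then show ?thesis using \<epsilon> by simp
      next
        case (Suc l)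
        have "sum \<psi> {..<k} = sum \<phi> (r ` {..<k})"
          unfolding \<psi>_def using mono by (subst sum.reindex) (auto intro: strict_mono_imp_inj_on inj_on_subset)
        also have "\<dots> \<le> sum \<phi> {..r l}"
          using mono \<phi> Suc by (intro sum_mono2) (auto simp: strict_mono_less_eq)
        finally have "4 ^ k * blinfun_apply (sum \<psi> {..<k}) (u (r k)) \<le> 4 ^ k * blinfun_apply (sum \<phi> {..r l}) (u (r k))"
          using u by (intro mult_left_mono blinfun_le) auto
        also have "\<dots> \<le> \<epsilon> / 4" using r(2)[of l] by (simp add: Suc)
        finally show ?thesis .
      qed
      have "(1 / 2) ^ k * blinfun_apply \<Phi> (u (r k)) \<le> 1 * blinfun_apply \<Phi> (u (r k))"
        using blinfun_nonneg[OF \<Phi>_nonneg u] by (intro mult_right_mono) (simp_all add: power_le_one)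
      moreover have "\<epsilon> \<le> blinfun_apply (\<psi> k) (u (r k))"
        using blinfun_le[OF functional_pprt_ge u, of "f (r k)" "r k"] big[of "r k"] by (simp add: \<psi>_def \<phi>_def)
      ultimately have "\<epsilon> / 2 \<le> blinfun_apply (a k) (u (r k))"
        using 1 elim by (simp add: a_def blinfun.diff_left blinfun.scaleR_left)
      also have "\<dots> \<le> blinfun_apply (g k) (u (r k))"
        unfolding g_def using u by (intro blinfun_le functional_pprt_ge)
      finally show ?case .
    qed
  qed
qed

section \<open>Bounded disjoint sequences under an order continuous dual norm\<close>

text \<open>A substitute for composing \<open>f\<close> with a band projection: the vectors
  \<open>inf x (t *\<^sub>R u)\<close> may have no supremum, but their values under \<open>f\<close>
  do. Superadditivity holds because the multiples \<open>s\<close> and \<open>t\<close> of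
  \<open>u\<close> add up.\<close>

lemma band_functional:
  fixes f :: "'a::banach_lattice \<Rightarrow>\<^sub>L real"
  assumes f: "0 \<le> f" and u: "0 \<le> u"
  obtains g :: "'a \<Rightarrow>\<^sub>L real" where "\<And>x. 0 \<le> x \<Longrightarrow> blinfun_apply g x = (SUP t\<in>{0..}. blinfun_apply f (inf x (t *\<^sub>R u)))"
proof -
  define p where "p x = (SUP t\<in>{0..}. blinfun_apply f (inf x (t *\<^sub>R u)))" for x
  have bdd: "bdd_above ((\<lambda>t. blinfun_apply f (inf x (t *\<^sub>R u))) ` {0..})" for x
    using f by (intro bdd_aboveI2[where M = "blinfun_apply f x"] blinfun_mono) simp_all
  have upper: "blinfun_apply f (inf x (t *\<^sub>R u)) \<le> p x" if "0 \<le> t" for x t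
    unfolding p_def using bdd that by (intro cSUP_upper) auto
  have least: "p x \<le> a" if "\<And>t. 0 \<le> t \<Longrightarrow> blinfun_apply f (inf x (t *\<^sub>R u)) \<le> a" for x a
    unfolding p_def using that by (intro cSUP_least) auto
  have tu: "0 \<le> t *\<^sub>R u" if "0 \<le> t" for t using that u by (rule scaleR_nonneg_nonneg)
  obtain g :: "'a \<Rightarrow>\<^sub>L real" where "\<And>x. 0 \<le> x \<Longrightarrow> blinfun_apply g x = p x"
  proof (rule positive_functional_extension[of p "norm f"])
    fix x y :: 'a assume xy: "0 \<le> x" "0 \<le> y"
    show "p (x + y) = p x + p y"
    proof (rule antisym)
      show "p (x + y) \<le> p x + p y"
      proof (rule least)
        fix t :: real assume t: "0 \<le> t"
        have "inf (x + y) (t *\<^sub>R u) \<le> inf x (t *\<^sub>R u) + inf y (t *\<^sub>R u)"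
          using inf_add_le[OF tu[OF t] xy] by (simp only: inf.commute)
        then have "blinfun_apply f (inf (x + y) (t *\<^sub>R u)) \<le> blinfun_apply f (inf x (t *\<^sub>R u) + inf y (t *\<^sub>R u))"
          by (rule blinfun_mono[OF f])
        also have "\<dots> \<le> p x + p y"
          using upper[OF t, of x] upper[OF t, of y] by (simp add: blinfun.add_right)
        finally show "blinfun_apply f (inf (x + y) (t *\<^sub>R u)) \<le> p x + p y" .
      qed
      have "p x \<le> p (x + y) - p y"
      proof (rule least)
        fix s :: real assume s: "0 \<le> s"
        have "p y \<le> p (x + y) - blinfun_apply f (inf x (s *\<^sub>R u))"
        proof (rule least)
          fix t :: real assume t: "0 \<le> t"
          have "inf x (s *\<^sub>R u) + inf y (t *\<^sub>R u) \<le> s *\<^sub>R u + t *\<^sub>R u"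
            by (intro add_mono inf_le2)
          then have "inf x (s *\<^sub>R u) + inf y (t *\<^sub>R u) \<le> inf (x + y) ((s + t) *\<^sub>R u)"
            by (intro le_infI add_mono inf_le1) (simp add: scaleR_add_left)
          then have "blinfun_apply f (inf x (s *\<^sub>R u) + inf y (t *\<^sub>R u)) \<le> blinfun_apply f (inf (x + y) ((s + t) *\<^sub>R u))"
            by (rule blinfun_mono[OF f])
          also have "\<dots> \<le> p (x + y)" using s t by (intro upper) simp
          finally show "blinfun_apply f (inf y (t *\<^sub>R u)) \<le> p (x + y) - blinfun_apply f (inf x (s *\<^sub>R u))"
            by (simp add: blinfun.add_right)
        qed
        then show "blinfun_apply f (inf x (s *\<^sub>R u)) \<le> p (x + y) - p y" by simp
      qed
      then show "p x + p y \<le> p (x + y)" by simp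
    qed
  next
    fix c :: real and x :: 'a assume c: "0 < c" and x: "0 \<le> x"
    have le: "p (c *\<^sub>R x) \<le> c * p x" if c: "0 < c" for c x
    proof (rule least)
      fix t :: real assume t: "0 \<le> t"
      have "inf (c *\<^sub>R x) (t *\<^sub>R u) = c *\<^sub>R inf x ((t / c) *\<^sub>R u)"
        using inf_scaleR[OF c, of x "(t / c) *\<^sub>R u"] c by simp
      then show "blinfun_apply f (inf (c *\<^sub>R x) (t *\<^sub>R u)) \<le> c * p x"
        using upper[of "t / c" x] c t by (simp add: blinfun.scaleR_right)
    qed
    have "p ((1 / c) *\<^sub>R (c *\<^sub>R x)) \<le> 1 / c * p (c *\<^sub>R x)"
      using c by (intro le) simp
    then show "p (c *\<^sub>R x) = c * p x"
      using le[OF c, of x] c by (simp add: field_simps)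
  next
    fix x :: 'a assume x: "0 \<le> x"
    show "0 \<le> p x" using upper[of 0 x] x by (simp add: inf_absorb2)
    show "p x \<le> norm f * norm x"
    proof (rule least)
      fix t :: real
      have "blinfun_apply f (inf x (t *\<^sub>R u)) \<le> blinfun_apply f x" using f by (intro blinfun_mono) simp_all
      also have "\<dots> \<le> norm f * norm x" by (rule blinfun_le_norm)
      finally show "blinfun_apply f (inf x (t *\<^sub>R u)) \<le> norm f * norm x" .
    qed
  qed blast
  then show thesis unfolding p_def by (rule that)
qed

text \<open>The component \<open>g n\<close> agrees with \<open>f\<close> at \<open>x n\<close> and
  is part of the tail \<open>d n\<close>, whence \<open>f (x n) \<le> norm (d n) * M\<close>. Norm
  convergence of the tails is essential, since the vector moves with \<open>n\<close>.\<close>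

lemma disjoint_bounded_null_of_order_continuous_dual:
  fixes x :: "nat \<Rightarrow> 'a::banach_lattice" and f :: "'a \<Rightarrow>\<^sub>L real"
  assumes oc: "order_continuous_norm TYPE('a \<Rightarrow>\<^sub>L real)" and f: "0 \<le> f"
    and x: "\<And>n. 0 \<le> x n" and disj: "\<And>m n. m \<noteq> n \<Longrightarrow> inf (x m) (x n) = 0"
    and M: "\<And>n. norm (x n) \<le> M"
  shows "(\<lambda>n. blinfun_apply f (x n)) \<longlonglongrightarrow> 0"
proof -
  have "\<exists>h :: 'a \<Rightarrow>\<^sub>L real. \<forall>y\<ge>0. blinfun_apply h y = (SUP t\<in>{0..}. blinfun_apply f (inf y (t *\<^sub>R x n)))" for n
    by (rule band_functional[OF f x]) blast
  then have "\<exists>g. \<forall>n. \<forall>y\<ge>0. blinfun_apply (g n) y = (SUP t\<in>{0..}. blinfun_apply f (inf y (t *\<^sub>R x n)))"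
    by (intro choice allI)
  then obtain g :: "nat \<Rightarrow> 'a \<Rightarrow>\<^sub>L real" where g: "\<And>n y. 0 \<le> y \<Longrightarrow>
      blinfun_apply (g n) y = (SUP t\<in>{0..}. blinfun_apply f (inf y (t *\<^sub>R x n)))"
    by blast
  have bdd: "bdd_above ((\<lambda>t. blinfun_apply f (inf y (t *\<^sub>R x n))) ` {0..})" for y n
    using f by (intro bdd_aboveI2[where M = "blinfun_apply f y"] blinfun_mono) simp_all
  have upper: "blinfun_apply f (inf y (t *\<^sub>R x n)) \<le> blinfun_apply (g n) y" if "0 \<le> t" "0 \<le> y" for y t n
    unfolding g[OF that(2)] using bdd that by (intro cSUP_upper) auto
  have nonneg: "0 \<le> g n" for n
    unfolding less_eq_blinfun_def
  proof (intro allI impI)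
    fix y :: 'a assume y: "0 \<le> y"
    then show "blinfun_apply 0 y \<le> blinfun_apply (g n) y"
      using upper[of 0 y n] by (simp add: inf_absorb2)
  qed
  have sum_le: "(\<Sum>n<N. blinfun_apply (g n) y) \<le> blinfun_apply f y" if y: "0 \<le> y" for N y
  proof (rule field_le_epsilon)
    fix e :: real assume e: "0 < e"
    \<comment> \<open>The error allowed in each of the \<open>N\<close> suprema; adding 1 covers
      \<open>N = 0\<close>.\<close>
    define \<delta> where "\<delta> = e / (real N + 1)"
    have \<delta>: "0 < \<delta>" "real N * \<delta> \<le> e" using e by (simp_all add: \<delta>_def field_simps)
    have "\<exists>t\<ge>0. blinfun_apply (g n) y - \<delta> < blinfun_apply f (inf y (t *\<^sub>R x n))" for n
    proof -
      have "\<exists>t\<in>{0..}. blinfun_apply (g n) y - \<delta> < blinfun_apply f (inf y (t *\<^sub>R x n))"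
        using \<delta>(1) g[OF y, of n] by (intro less_cSUP_iff[THEN iffD1] bdd) auto
      then show ?thesis by auto
    qed
    then obtain t where t: "\<And>n. 0 \<le> t n"
        "\<And>n. blinfun_apply (g n) y - \<delta> < blinfun_apply f (inf y (t n *\<^sub>R x n))" by metis
    have tx: "0 \<le> t n *\<^sub>R x n" for n using t(1) x by (rule scaleR_nonneg_nonneg)
    have disj': "inf (t m *\<^sub>R x m) (t n *\<^sub>R x n) = 0" if "m \<noteq> n" for m n
    proof -
      \<comment> \<open>Disjointness survives a common positive factor, and different multiples are
        dominated by one.\<close>
      let ?s = "max 1 (max (t m) (t n))"
      have "t m *\<^sub>R x m \<le> ?s *\<^sub>R x m" "t n *\<^sub>R x n \<le> ?s *\<^sub>R x n"
        using x by (intro scaleR_right_mono; simp)+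
      moreover have "inf (?s *\<^sub>R x m) (?s *\<^sub>R x n) = 0"
        using inf_scaleR[of ?s "x m" "x n"] disj[OF that] by simp
      ultimately show ?thesis using tx inf_eq_0_mono by blast
    qed
    have "(\<Sum>n<N. inf y (t n *\<^sub>R x n)) \<le> y"
    proof (rule sum_le_of_pairwise_disjoint)
      fix m n :: nat assume "m \<noteq> n"
      then show "inf (inf y (t m *\<^sub>R x m)) (inf y (t n *\<^sub>R x n)) = 0"
        using y tx by (intro inf_eq_0_mono[OF disj'[OF \<open>m \<noteq> n\<close>]]) simp_all
    qed (use y tx in simp_all)
    then have "blinfun_apply f (\<Sum>n<N. inf y (t n *\<^sub>R x n)) \<le> blinfun_apply f y"
      by (rule blinfun_mono[OF f])
    moreover have "(\<Sum>n<N. blinfun_apply (g n) y) \<le> (\<Sum>n<N. blinfun_apply f (inf y (t n *\<^sub>R x n)) + \<delta>)"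
      using t(2) by (intro sum_mono) (metis diff_le_eq less_imp_le)
    ultimately show "(\<Sum>n<N. blinfun_apply (g n) y) \<le> blinfun_apply f y + e"
      using \<delta>(2) by (simp add: blinfun.sum_right sum.distrib)
  qed
  have g_nonneg: "0 \<le> blinfun_apply (g n) y" if "0 \<le> y" for n y
    using nonneg that by (rule blinfun_nonneg)
  have summ: "summable (\<lambda>n. blinfun_apply (g n) y)" if y: "0 \<le> y" for y
    using g_nonneg[OF y] sum_le[OF y] by (rule summableI_nonneg_bounded)
  obtain s :: "'a \<Rightarrow>\<^sub>L real" where s: "\<And>y. 0 \<le> y \<Longrightarrow> blinfun_apply s y = (\<Sum>n. blinfun_apply (g n) y)"
  proof (rule positive_functional_extension[of "\<lambda>y. \<Sum>n. blinfun_apply (g n) y" "norm f"])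
    fix y z :: 'a assume "0 \<le> y" "0 \<le> z"
    then show "(\<Sum>n. blinfun_apply (g n) (y + z)) = (\<Sum>n. blinfun_apply (g n) y) + (\<Sum>n. blinfun_apply (g n) z)"
      by (simp add: blinfun.add_right suminf_add summ)
  next
    fix c :: real and y :: 'a assume "0 \<le> y"
    then show "(\<Sum>n. blinfun_apply (g n) (c *\<^sub>R y)) = c * (\<Sum>n. blinfun_apply (g n) y)"
      by (simp add: blinfun.scaleR_right suminf_mult summ)
  next
    fix y :: 'a assume y: "0 \<le> y"
    show "0 \<le> (\<Sum>n. blinfun_apply (g n) y)" using summ y g_nonneg by (intro suminf_nonneg)
    have "(\<Sum>n. blinfun_apply (g n) y) \<le> blinfun_apply f y"
      using summ[OF y] sum_le[OF y] by (rule suminf_le_const)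
    also have "\<dots> \<le> norm f * norm y" by (rule blinfun_le_norm)
    finally show "(\<Sum>n. blinfun_apply (g n) y) \<le> norm f * norm y" .
  qed blast
  define d where "d N = s - sum g {..<N}" for N
  have d_apply: "blinfun_apply (d N) y = (\<Sum>n. blinfun_apply (g n) y) - (\<Sum>n<N. blinfun_apply (g n) y)"
    if "0 \<le> y" for N y
    using that by (simp add: d_def s blinfun.diff_left blinfun.sum_left)
  have d_nonneg: "0 \<le> d N" for N
    unfolding less_eq_blinfun_def
    using sum_le_suminf[OF summ] g_nonneg by (simp add: d_apply)
  have d_Suc: "d N = d (Suc N) + g N" for N by (simp add: d_def)
  have d_anti: "d n \<le> d m" if "m \<le> n" for m n
  proof (rule lift_Suc_antimono_le[OF _ that])
    show "d (Suc k) \<le> d k" for k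
      unfolding d_Suc[of k] using nonneg[of k] by simp
  qed
  \<comment> \<open>The order of the dual is tested pointwise on the cone, where the tails of the
    convergent series tend to 0.\<close>
  have glb: "isGlb UNIV (range d) 0"
  proof (rule isGlbI2)
    show "isLb UNIV (range d) 0" using d_nonneg by (auto simp: isLb_def setge_def)
    show "Collect (isLb UNIV (range d)) *<= 0"
    proof (rule setleI, rule ballI)
      fix h assume "h \<in> Collect (isLb UNIV (range d))"
      then have h: "h \<le> d N" for N by (auto simp: isLb_def setge_def)
      show "h \<le> 0"
        unfolding less_eq_blinfun_def
      proof (intro allI impI)
        fix y :: 'a assume y: "0 \<le> y"
        have "(\<lambda>N. blinfun_apply (d N) y) \<longlonglongrightarrow> (\<Sum>n. blinfun_apply (g n) y) - (\<Sum>n. blinfun_apply (g n) y)"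
          unfolding d_apply[OF y] by (intro tendsto_diff tendsto_const summable_LIMSEQ summ y)
        then have "blinfun_apply h y \<le> (\<Sum>n. blinfun_apply (g n) y) - (\<Sum>n. blinfun_apply (g n) y)"
          using blinfun_le[OF h y] by (intro LIMSEQ_le_const) auto
        then show "blinfun_apply h y \<le> blinfun_apply 0 y" by simp
      qed
    qed
  qed
  have d_null: "d \<longlonglongrightarrow> 0"
  proof (rule LIMSEQ_I)
    fix e :: real assume e: "0 < e"
    have "\<exists>i\<in>UNIV. \<forall>j\<in>UNIV. i \<le> j \<longrightarrow> norm (d j) < e"
    proof (rule order_continuous_norm_net[OF oc])
      show "\<exists>k\<in>UNIV. i \<le> k \<and> j \<le> k" for i j :: nat by (intro bexI[of _ "max i j"]) auto
    qed (use d_anti glb e in auto)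
    then show "\<exists>N. \<forall>n\<ge>N. norm (d n - 0) < e" by auto
  qed
  have "blinfun_apply f (x n) \<le> norm (d n) * M" for n
  proof -
    \<comment> \<open>The case \<open>t = 1\<close> of the supremum, as
      \<open>inf (x n) (x n) = x n\<close>.\<close>
    have "blinfun_apply f (x n) \<le> blinfun_apply (g n) (x n)"
      using upper[of 1 "x n" n] x by simp
    also have "\<dots> \<le> blinfun_apply (d n) (x n)"
      using blinfun_nonneg[OF d_nonneg x, of "Suc n" n] d_Suc[of n] by (simp add: blinfun.add_left)
    also have "\<dots> \<le> norm (d n) * norm (x n)" by (rule blinfun_le_norm)
    also have "\<dots> \<le> norm (d n) * M" using M by (intro mult_left_mono) auto
    finally show ?thesis .
  qed
  moreover have "(\<lambda>n. norm (d n) * M) \<longlonglongrightarrow> 0"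
    by (intro tendsto_mult_left_zero tendsto_norm_zero d_null)
  ultimately show ?thesis
    using blinfun_nonneg[OF f x]
      tendsto_sandwich[of "\<lambda>_. 0" "\<lambda>n. blinfun_apply f (x n)" sequentially "\<lambda>n. norm (d n) * M" 0]
    by simp
qed

theorem weakly_null_disjoint_bounded:
  fixes x :: "nat \<Rightarrow> 'a::banach_lattice"
  assumes oc: "order_continuous_norm TYPE('a \<Rightarrow>\<^sub>L real)" and x: "\<And>n. 0 \<le> x n"
    and disj: "\<And>m n. m \<noteq> n \<Longrightarrow> inf (x m) (x n) = 0" and bdd: "bounded (range x)"
  shows "weakly_null x"
  unfolding weakly_null_def
proof
  fix f :: "'a \<Rightarrow>\<^sub>L real"
  obtain M where M: "\<And>n. norm (x n) \<le> M" using bdd by (auto simp: bounded_iff)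
  let ?p = "functional_pprt f"
  have "0 \<le> ?p - f" using functional_pprt_ge by (metis diff_ge_0_iff_ge)
  then have "(\<lambda>n. blinfun_apply ?p (x n) - blinfun_apply (?p - f) (x n)) \<longlonglongrightarrow> 0 - 0"
    by (intro tendsto_diff disjoint_bounded_null_of_order_continuous_dual[OF oc _ x disj M]) auto
  then show "(\<lambda>n. blinfun_apply f (x n)) \<longlonglongrightarrow> 0"
    by (simp add: blinfun.diff_left)
qed

section \<open>The equivalence for positive operators\<close>

text \<open>The estimate is one-sided because the minorants are extracted from lower bounds without
  modulus; applied to \<open>f\<close> and to \<open>- f\<close> it gives convergence. The
  \<open>g k\<close> are paired with the subsequence of \<open>x\<close> that produced them, which
  is still disjoint and weakly null.\<close>

lemma almost_weak_star_Dunford_Pettis_upper: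
  fixes T :: "'a::banach_lattice \<Rightarrow>\<^sub>L 'b::banach_lattice"
  assumes complete: "sigma_dedekind_complete TYPE('b)" and T: "0 \<le> T"
    and almost: "almost_weak_star_Dunford_Pettis T"
    and x: "\<And>n. 0 \<le> x n" "disjoint_sequence x" "weakly_null x"
    and f: "weak_star_null f" and \<epsilon>: "0 < \<epsilon>"
  shows "\<forall>\<^sub>F n in sequentially. blinfun_apply (f n) (blinfun_apply T (x n)) < \<epsilon>"
proof (rule ccontr)
  assume "\<not> ?thesis"
  then have "infinite {n. \<epsilon> \<le> blinfun_apply (f n) (blinfun_apply T (x n))}" (is "infinite ?K")
    by (auto simp: eventually_sequentially infinite_nat_iff_unbounded_le not_less)
  define s where "s = enumerate ?K"
  have s: "strict_mono s" unfolding s_def using \<open>infinite ?K\<close> by (rule strict_mono_enumerate)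
  have big: "\<epsilon> \<le> blinfun_apply (f (s n)) (blinfun_apply T (x (s n)))" for n
    using enumerate_in_set[OF \<open>infinite ?K\<close>, of n] by (simp add: s_def)
  have sub: "weakly_null (\<lambda>n. x (t n))" "weak_star_null (\<lambda>n. f (t n))" if "strict_mono t" for t
    using x(3) f LIMSEQ_subseq_LIMSEQ[OF _ that] by (auto simp: weakly_null_def weak_star_null_def o_def)
  have "0 \<le> blinfun_apply T (x (s n))" for n using T x(1) by (rule blinfun_nonneg)
  moreover have "weakly_null (\<lambda>n. blinfun_apply T (x (s n)))"
    unfolding weakly_null_def
  proof
    fix h :: "'b \<Rightarrow>\<^sub>L real"
    have "(\<lambda>n. blinfun_apply (h o\<^sub>L T) (x (s n))) \<longlonglongrightarrow> 0"
      using sub(1)[OF s] unfolding weakly_null_def by blast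
    then show "(\<lambda>n. blinfun_apply h (blinfun_apply T (x (s n)))) \<longlonglongrightarrow> 0" by simp
  qed
  moreover have "bounded (range (\<lambda>n. f (s n)))"
    using sub(2)[OF s] by (rule weak_star_null_bounded)
  ultimately obtain r g where r: "strict_mono r"
      and g: "\<And>k. 0 \<le> g k" "\<And>k. g k \<le> functional_pprt (f (s (r k)))" "disjoint_sequence g"
      and large: "\<forall>\<^sub>F k in sequentially. \<epsilon> / 2 \<le> blinfun_apply (g k) (blinfun_apply T (x (s (r k))))"
    using disjoint_minorants[of "\<lambda>n. f (s n)" "\<lambda>n. blinfun_apply T (x (s n))" \<epsilon>] big \<epsilon> by blast
  have sr: "strict_mono (\<lambda>k. s (r k))" using s r by (auto simp: strict_mono_def)
  have "weak_star_null g"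
    using weak_star_null_dominated_disjoint[OF complete sub(2)[OF sr] g] .
  moreover have "disjoint_sequence (\<lambda>k. x (s (r k)))"
    using x(2) strict_mono_eq[OF sr] by (simp add: disjoint_sequence_def)
  ultimately have "(\<lambda>k. blinfun_apply (g k) (blinfun_apply T (x (s (r k))))) \<longlonglongrightarrow> 0"
    using almost sub(1)[OF sr] g(3) unfolding almost_weak_star_Dunford_Pettis_def by blast
  then have "\<forall>\<^sub>F k in sequentially. blinfun_apply (g k) (blinfun_apply T (x (s (r k)))) < \<epsilon> / 2"
    by (rule order_tendstoD) (use \<epsilon> in simp)
  with large have "\<forall>\<^sub>F k in sequentially. False"
    by eventually_elim simp
  then show False by simp
qed

lemma disjoint_weak_star_of_almost:
  fixes T :: "'a::banach_lattice \<Rightarrow>\<^sub>L 'b::banach_lattice"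
  assumes oc: "order_continuous_norm TYPE('a \<Rightarrow>\<^sub>L real)"
    and complete: "sigma_dedekind_complete TYPE('b)" and T: "0 \<le> T"
    and almost: "almost_weak_star_Dunford_Pettis T"
  shows "disjoint_weak_star_Dunford_Pettis T"
  unfolding disjoint_weak_star_Dunford_Pettis_def
proof (intro allI impI)
  fix x :: "nat \<Rightarrow> 'a" and f :: "nat \<Rightarrow> 'b \<Rightarrow>\<^sub>L real"
  assume bdd: "bounded (range x)" and disj: "disjoint_sequence x" and f: "weak_star_null f"
  \<comment> \<open>Allowing any \<open>y\<close> between 0 and the moduli treats the positive and
    the negative parts of \<open>x n\<close> at once; such \<open>y\<close> inherit disjointness and
    boundedness.\<close>
  have pos: "(\<lambda>n. blinfun_apply (f n) (blinfun_apply T (y n))) \<longlonglongrightarrow> 0"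
    if y: "\<And>n. 0 \<le> y n" "\<And>n. y n \<le> \<bar>x n\<bar>" for y
  proof -
    have inf: "inf (y m) (y n) = 0" if "m \<noteq> n" for m n
    proof (rule inf_eq_0_mono[OF _ y y])
      show "inf \<bar>x m\<bar> \<bar>x n\<bar> = 0"
        using disj that by (simp add: disjoint_sequence_def order_disjoint_iff_inf_abs)
    qed
    obtain M where M: "\<And>n. norm (x n) \<le> M" using bdd by (auto simp: bounded_iff)
    have "norm (y n) \<le> norm \<bar>x n\<bar>" for n using y by (rule norm_mono_nonneg)
    then have "norm (y n) \<le> M" for n using M[of n] unfolding norm_abs_lattice by (rule order.trans)
    then have "bounded (range y)" by (auto simp: bounded_iff)
    with oc y(1) inf have wn: "weakly_null y"
      by (rule weakly_null_disjoint_bounded)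
    have dy: "disjoint_sequence y"
      using inf y(1) by (simp add: disjoint_sequence_def order_disjoint_iff_inf_abs)
    have f': "weak_star_null (\<lambda>n. - f n)"
      using f tendsto_minus[of "\<lambda>n. blinfun_apply (f n) z" 0 for z]
      unfolding weak_star_null_def by (simp add: blinfun.minus_left)
    show ?thesis
    proof (rule tendstoI)
      fix e :: real assume e: "0 < e"
      show "\<forall>\<^sub>F n in sequentially. dist (blinfun_apply (f n) (blinfun_apply T (y n))) 0 < e"
        using almost_weak_star_Dunford_Pettis_upper[OF complete T almost y(1) dy wn f e]
          almost_weak_star_Dunford_Pettis_upper[OF complete T almost y(1) dy wn f' e]
        by eventually_elim (auto simp: blinfun.minus_left)
    qed
  qed
  have "(\<lambda>n. blinfun_apply (f n) (blinfun_apply T (pprt (x n)))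
      - blinfun_apply (f n) (blinfun_apply T (- nprt (x n)))) \<longlonglongrightarrow> 0 - 0"
    by (intro tendsto_diff pos) (simp_all add: abs_prts)
  moreover have "blinfun_apply (f n) (blinfun_apply T (x n)) = blinfun_apply (f n) (blinfun_apply T (pprt (x n)))
      - blinfun_apply (f n) (blinfun_apply T (- nprt (x n)))" for n
  proof -
    have "x n = pprt (x n) - (- nprt (x n))" using prts[of "x n"] by simp
    then show ?thesis by (metis blinfun.diff_right)
  qed
  ultimately show "(\<lambda>n. blinfun_apply (f n) (blinfun_apply T (x n))) \<longlonglongrightarrow> 0" by simp
qed

theorem corollary3p3:
  fixes T :: "'a::banach_lattice \<Rightarrow>\<^sub>L 'b::banach_lattice"
  assumes "order_continuous_norm TYPE('a \<Rightarrow>\<^sub>L real)"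
    and "sigma_dedekind_complete TYPE('b)"
    and "0 \<le> T"
  shows "almost_weak_star_Dunford_Pettis T \<longleftrightarrow> disjoint_weak_star_Dunford_Pettis T"
proof
  assume "disjoint_weak_star_Dunford_Pettis T"
  then show "almost_weak_star_Dunford_Pettis T"
    unfolding almost_weak_star_Dunford_Pettis_def disjoint_weak_star_Dunford_Pettis_def
    using weakly_null_bounded by blast
qed (rule disjoint_weak_star_of_almost[OF assms])

end
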